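(* Let $G$ be a three-dimensional Abelian Lie group with a bi-invariant metric $\langle\,,\rangle$ and let $\alpha$ be a unit speed curve in $G$ with Frenet frame $\{T,N,B\}$, curvature $\varkappa$ and torsion $\tau$. Then $\alpha$ is a slant helix if and only if $$\sigma_N=\frac{(\varkappa^2+\tau^2)^{3/2}}{\varkappa^2\left(\frac{\tau}{\varkappa}\right)'}$$ is a constant function (which includes that $(\tau/\varkappa)'$ vanishes nowhere, so that the quotient is defined).
   Context: $\mathfrak{g}$ is the Lie algebra of left-invariant vector fields of $G$ and $D$ is the Levi-Civita connection. Let $\{X_1,X_2,X_3\}$ be an orthonormal basis of $\mathfrak{g}$. Vector fields along $\alpha$ are written $W=\sum_i w_iX_i$ with smooth $w_i$; one sets $\dot W=\sum_i w_i'X_i$, and $D_{\alpha'}W=\dot W+\frac12[T,W]$ with $T=\alpha'$ (the bracket vanishes when $G$ is Abelian). The Frenet apparatus of a unit speed curve consists of the positively oriented orthonormal frame $T=\alpha',N,B=T\times N$, the curvature $\varkappa=\|\dot T\|>0$ and the torsion $\tau$, with $D_TT=\varkappa N$, $D_TN=-\varkappa T+\tau B$, $D_TB=-\tau N$. Prime denotes differentiation with respect to the arc length $s$. Slant helix: $\alpha$ is a slant helix if there is a unit length left-invariant vector field $X\in\mathfrak{g}$ and a constant angle $\theta\ne\frac{\pi}{2}$ such that $\langle N(s),X\rangle=\cos\theta$ for all $s$. *)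

theory Defs
  imports "HOL-Analysis.Analysis"
begin

section \<open>Smooth maps between manifolds\<close>

text \<open>\<open>Ck_on n S f\<close> is only meant for open \<open>S\<close> and finite-dimensional domains, where it is the
  usual class $C^n$.\<close>

primrec Ck_on :: "nat \<Rightarrow> 'a::real_normed_vector set \<Rightarrow> ('a \<Rightarrow> 'b::real_normed_vector) \<Rightarrow> bool" where
  "Ck_on 0 S f \<longleftrightarrow> continuous_on S f"
| "Ck_on (Suc n) S f \<longleftrightarrow> (\<forall>x\<in>S. f differentiable (at x)) \<and>
     (\<forall>v. Ck_on n S (\<lambda>x. frechet_derivative f (at x) v))"

definition smooth_on :: "'a::real_normed_vector set \<Rightarrow> ('a \<Rightarrow> 'b::real_normed_vector) \<Rightarrow> bool" where
  "smooth_on S f \<longleftrightarrow> (\<forall>n. Ck_on n S f)"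

text \<open>A chart is a pair of its domain and its coordinate map. The values of the coordinate map
  outside the domain are irrelevant. Atlases need not be maximal.\<close>

type_synonym ('g, 'e) atlas = "('g set \<times> ('g \<Rightarrow> 'e)) set"

definition smooth_atlas :: "('g::topological_space, 'e::euclidean_space) atlas \<Rightarrow> bool" where
  "smooth_atlas A \<longleftrightarrow>
     (\<Union>(U, \<phi>)\<in>A. U) = UNIV \<and>
     (\<forall>(U, \<phi>)\<in>A. open U \<and> open (\<phi> ` U) \<and> homeomorphism U (\<phi> ` U) \<phi> (inv_into U \<phi>)) \<and>
     (\<forall>(U, \<phi>)\<in>A. \<forall>(V, \<psi>)\<in>A. smooth_on (\<phi> ` (U \<inter> V)) (\<psi> \<circ> inv_into U \<phi>))"

definition std_atlas :: "('e, 'e::euclidean_space) atlas" where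
  "std_atlas = {(UNIV, \<lambda>x. x)}"

definition prod_atlas :: "('g, 'd) atlas \<Rightarrow> ('h, 'e) atlas \<Rightarrow> ('g \<times> 'h, 'd \<times> 'e) atlas" where
  "prod_atlas A B = {(U \<times> V, map_prod \<phi> \<psi>) | U \<phi> V \<psi>. (U, \<phi>) \<in> A \<and> (V, \<psi>) \<in> B}"

definition smooth_map_on ::
  "'g::topological_space set \<Rightarrow> ('g, 'd::euclidean_space) atlas \<Rightarrow>
   ('h::topological_space, 'e::euclidean_space) atlas \<Rightarrow> ('g \<Rightarrow> 'h) \<Rightarrow> bool" where
  "smooth_map_on S A B f \<longleftrightarrow> open S \<and> continuous_on S f \<and>
     (\<forall>(U, \<phi>)\<in>A. \<forall>(V, \<psi>)\<in>B. smooth_on (\<phi> ` (S \<inter> U \<inter> f -` V)) (\<psi> \<circ> f \<circ> inv_into U \<phi>))"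

abbreviation smooth_fun :: "('g::topological_space, 'e::euclidean_space) atlas \<Rightarrow> ('g \<Rightarrow> real) \<Rightarrow> bool" where
  "smooth_fun A \<equiv> smooth_map_on UNIV A std_atlas"

section \<open>Tangent vectors and vector fields\<close>

text \<open>Tangent vectors are the velocities of smooth curves, acting on smooth functions as
  directional derivatives. Setting them to 0 on functions that are not smooth makes the
  representing functional unique.\<close>

type_synonym 'g tvec = "('g \<Rightarrow> real) \<Rightarrow> real"

definition velocity ::
  "('g::topological_space, 'e::euclidean_space) atlas \<Rightarrow> (real \<Rightarrow> 'g) \<Rightarrow> real \<Rightarrow> 'g tvec" where
  "velocity A \<gamma> s = (\<lambda>f. if smooth_fun A f then deriv (\<lambda>t. f (\<gamma> t)) s else 0)"

definition tangent_space ::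
  "('g::topological_space, 'e::euclidean_space) atlas \<Rightarrow> 'g \<Rightarrow> 'g tvec set" where
  "tangent_space A p = {velocity A \<gamma> 0 | \<gamma>. \<gamma> 0 = p \<and>
     (\<exists>\<epsilon>>0. smooth_map_on {-\<epsilon><..<\<epsilon>} std_atlas A \<gamma>)}"

definition smooth_vector_field ::
  "('g::topological_space, 'e::euclidean_space) atlas \<Rightarrow> ('g \<Rightarrow> 'g tvec) \<Rightarrow> bool" where
  "smooth_vector_field A X \<longleftrightarrow> (\<forall>p. X p \<in> tangent_space A p) \<and>
     (\<forall>f. smooth_fun A f \<longrightarrow> smooth_fun A (\<lambda>p. X p f))"

text \<open>Only used for diffeomorphisms \<open>F\<close>, so that \<open>f\<close> is smooth iff \<open>f \<circ> F\<close> is.\<close>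

definition pushforward :: "('g \<Rightarrow> 'g) \<Rightarrow> 'g tvec \<Rightarrow> 'g tvec" where
  "pushforward F u = (\<lambda>f. u (f \<circ> F))"

definition lie_bracket :: "('g \<Rightarrow> 'g tvec) \<Rightarrow> ('g \<Rightarrow> 'g tvec) \<Rightarrow> 'g \<Rightarrow> 'g tvec" where
  "lie_bracket X Y p = (\<lambda>f. X p (\<lambda>q. Y q f) - Y p (\<lambda>q. X q f))"

section \<open>Lie groups\<close>

text \<open>The group operation is written additively. The class \<open>group_add\<close> does not include
  commutativity.\<close>

definition lie_group ::
  "('g::{group_add,t2_space,second_countable_topology}, 'e::euclidean_space) atlas \<Rightarrow> bool" where
  "lie_group A \<longleftrightarrow> smooth_atlas A \<and>
     smooth_map_on UNIV (prod_atlas A A) A (\<lambda>(x, y). x + y) \<and>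
     smooth_map_on UNIV A A (\<lambda>x. - x)"

definition lie_algebra ::
  "('g::{group_add,topological_space}, 'e::euclidean_space) atlas \<Rightarrow> ('g \<Rightarrow> 'g tvec) set" where
  "lie_algebra A = {X. smooth_vector_field A X \<and>
     (\<forall>g p. X (g + p) = pushforward (\<lambda>x. g + x) (X p))}"

type_synonym 'g metric = "'g \<Rightarrow> 'g tvec \<Rightarrow> 'g tvec \<Rightarrow> real"

definition riemannian_metric ::
  "('g::topological_space, 'e::euclidean_space) atlas \<Rightarrow> 'g metric \<Rightarrow> bool" where
  "riemannian_metric A m \<longleftrightarrow>
     (\<forall>p. \<forall>u\<in>tangent_space A p. \<forall>v\<in>tangent_space A p. m p u v = m p v u) \<and>
     (\<forall>p. \<forall>u\<in>tangent_space A p. \<forall>v\<in>tangent_space A p. \<forall>w\<in>tangent_space A p. \<forall>a b.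
        m p (\<lambda>f. a * u f + b * v f) w = a * m p u w + b * m p v w) \<and>
     (\<forall>p. \<forall>u\<in>tangent_space A p. u \<noteq> (\<lambda>f. 0) \<longrightarrow> m p u u > 0) \<and>
     (\<forall>X Y. smooth_vector_field A X \<longrightarrow> smooth_vector_field A Y \<longrightarrow>
        smooth_fun A (\<lambda>p. m p (X p) (Y p)))"

definition bi_invariant_metric ::
  "('g::{group_add,topological_space}, 'e::euclidean_space) atlas \<Rightarrow> 'g metric \<Rightarrow> bool" where
  "bi_invariant_metric A m \<longleftrightarrow> riemannian_metric A m \<and>
     (\<forall>g p. \<forall>u\<in>tangent_space A p. \<forall>v\<in>tangent_space A p.
        m (g + p) (pushforward (\<lambda>x. g + x) u) (pushforward (\<lambda>x. g + x) v) = m p u v \<and>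
        m (p + g) (pushforward (\<lambda>x. x + g) u) (pushforward (\<lambda>x. x + g) v) = m p u v)"

text \<open>\<open>lincomb X p c\<close> is the tangent vector $\sum_i c_i X_i(p)$.\<close>

definition lincomb :: "('n \<Rightarrow> 'g \<Rightarrow> 'g tvec) \<Rightarrow> 'g \<Rightarrow> real ^ 'n \<Rightarrow> 'g tvec" where
  "lincomb X p c = (\<lambda>f. \<Sum>i\<in>UNIV. c $ i * X i p f)"

definition orthonormal_basis ::
  "('g::{group_add,topological_space}, 'e::euclidean_space) atlas \<Rightarrow> 'g metric \<Rightarrow>
   ('n::finite \<Rightarrow> 'g \<Rightarrow> 'g tvec) \<Rightarrow> bool" where
  "orthonormal_basis A m X \<longleftrightarrow> (\<forall>i. X i \<in> lie_algebra A) \<and>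
     (\<forall>Y\<in>lie_algebra A. \<exists>c. Y = (\<lambda>p. lincomb X p c)) \<and>
     (\<forall>i j p. m p (X i p) (X j p) = (if i = j then 1 else 0))"

section \<open>Vector fields along a curve\<close>

text \<open>Coefficients of a vector field along \<open>\<alpha>\<close> in the orthonormal frame \<open>X\<close>.\<close>

definition coeffs ::
  "'g metric \<Rightarrow> ('n::finite \<Rightarrow> 'g \<Rightarrow> 'g tvec) \<Rightarrow> (real \<Rightarrow> 'g) \<Rightarrow> (real \<Rightarrow> 'g tvec) \<Rightarrow> real \<Rightarrow> real ^ 'n" where
  "coeffs m X \<alpha> W s = (\<chi> i. m (\<alpha> s) (W s) (X i (\<alpha> s)))"

definition smooth_field_along ::
  "'g metric \<Rightarrow> ('n::finite \<Rightarrow> 'g \<Rightarrow> 'g tvec) \<Rightarrow> real set \<Rightarrow> (real \<Rightarrow> 'g) \<Rightarrow> (real \<Rightarrow> 'g tvec) \<Rightarrow> bool" where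
  "smooth_field_along m X I \<alpha> W \<longleftrightarrow> smooth_on I (coeffs m X \<alpha> W) \<and>
     (\<forall>s\<in>I. W s = lincomb X (\<alpha> s) (coeffs m X \<alpha> W s))"

definition dot_along ::
  "'g metric \<Rightarrow> ('n::finite \<Rightarrow> 'g \<Rightarrow> 'g tvec) \<Rightarrow> (real \<Rightarrow> 'g) \<Rightarrow> (real \<Rightarrow> 'g tvec) \<Rightarrow> real \<Rightarrow> 'g tvec" where
  "dot_along m X \<alpha> W s = lincomb X (\<alpha> s) (vector_derivative (coeffs m X \<alpha> W) (at s))"

text \<open>For vector fields along a curve the bracket is that of \<open>lie_algebra\<close>, taken for each
  parameter value with the coefficients frozen.\<close>

definition bracket_along ::
  "'g metric \<Rightarrow> ('n::finite \<Rightarrow> 'g \<Rightarrow> 'g tvec) \<Rightarrow> (real \<Rightarrow> 'g) \<Rightarrow> (real \<Rightarrow> 'g tvec) \<Rightarrow>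
   (real \<Rightarrow> 'g tvec) \<Rightarrow> real \<Rightarrow> 'g tvec" where
  "bracket_along m X \<alpha> V W s =
     lie_bracket (\<lambda>p. lincomb X p (coeffs m X \<alpha> V s)) (\<lambda>p. lincomb X p (coeffs m X \<alpha> W s)) (\<alpha> s)"

text \<open>The Levi-Civita derivative of \<open>W\<close> along a curve with velocity field \<open>T\<close>, for a bi-invariant
  metric: $D_T W = \dot W + \frac{1}{2}[T,W]$.\<close>

definition cov_deriv_along ::
  "'g metric \<Rightarrow> ('n::finite \<Rightarrow> 'g \<Rightarrow> 'g tvec) \<Rightarrow> (real \<Rightarrow> 'g) \<Rightarrow> (real \<Rightarrow> 'g tvec) \<Rightarrow>
   (real \<Rightarrow> 'g tvec) \<Rightarrow> real \<Rightarrow> 'g tvec" where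
  "cov_deriv_along m X \<alpha> T W s =
     (\<lambda>f. dot_along m X \<alpha> W s f + 1/2 * bracket_along m X \<alpha> T W s f)"

text \<open>The basis \<open>X\<close> is declared positively oriented, which fixes the cross product.\<close>

definition cross_along ::
  "'g metric \<Rightarrow> (3 \<Rightarrow> 'g \<Rightarrow> 'g tvec) \<Rightarrow> (real \<Rightarrow> 'g) \<Rightarrow> (real \<Rightarrow> 'g tvec) \<Rightarrow>
   (real \<Rightarrow> 'g tvec) \<Rightarrow> real \<Rightarrow> 'g tvec" where
  "cross_along m X \<alpha> V W s = lincomb X (\<alpha> s) (cross3 (coeffs m X \<alpha> V s) (coeffs m X \<alpha> W s))"

definition unit_speed_curve ::
  "('g::topological_space, 'e::euclidean_space) atlas \<Rightarrow> 'g metric \<Rightarrow> real set \<Rightarrow> (real \<Rightarrow> 'g) \<Rightarrow> bool" where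
  "unit_speed_curve A m I \<alpha> \<longleftrightarrow> smooth_map_on I std_atlas A \<alpha> \<and>
     (\<forall>s\<in>I. sqrt (m (\<alpha> s) (velocity A \<alpha> s) (velocity A \<alpha> s)) = 1)"

definition frenet_apparatus ::
  "('g::topological_space, 'e::euclidean_space) atlas \<Rightarrow> 'g metric \<Rightarrow> (3 \<Rightarrow> 'g \<Rightarrow> 'g tvec) \<Rightarrow>
   real set \<Rightarrow> (real \<Rightarrow> 'g) \<Rightarrow> (real \<Rightarrow> 'g tvec) \<Rightarrow> (real \<Rightarrow> 'g tvec) \<Rightarrow> (real \<Rightarrow> 'g tvec) \<Rightarrow>
   (real \<Rightarrow> real) \<Rightarrow> (real \<Rightarrow> real) \<Rightarrow> bool" where
  "frenet_apparatus A m X I \<alpha> T N B \<kappa> \<tau> \<longleftrightarrow>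
     smooth_field_along m X I \<alpha> T \<and> smooth_field_along m X I \<alpha> N \<and> smooth_field_along m X I \<alpha> B \<and>
     (\<forall>s\<in>I. T s = velocity A \<alpha> s \<and>
        m (\<alpha> s) (T s) (T s) = 1 \<and> m (\<alpha> s) (N s) (N s) = 1 \<and> m (\<alpha> s) (T s) (N s) = 0 \<and>
        B s = cross_along m X \<alpha> T N s \<and>
        \<kappa> s = sqrt (m (\<alpha> s) (dot_along m X \<alpha> T s) (dot_along m X \<alpha> T s)) \<and> \<kappa> s > 0 \<and>
        cov_deriv_along m X \<alpha> T T s = (\<lambda>f. \<kappa> s * N s f) \<and>
        cov_deriv_along m X \<alpha> T N s = (\<lambda>f. - \<kappa> s * T s f + \<tau> s * B s f) \<and>
        cov_deriv_along m X \<alpha> T B s = (\<lambda>f. - \<tau> s * N s f))"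

definition slant_helix ::
  "('g::{group_add,topological_space}, 'e::euclidean_space) atlas \<Rightarrow> 'g metric \<Rightarrow>
   real set \<Rightarrow> (real \<Rightarrow> 'g) \<Rightarrow> (real \<Rightarrow> 'g tvec) \<Rightarrow> bool" where
  "slant_helix A m I \<alpha> N \<longleftrightarrow>
     (\<exists>Y\<in>lie_algebra A. (\<forall>p. sqrt (m p (Y p) (Y p)) = 1) \<and>
        (\<exists>\<theta>\<in>{0..pi}. \<theta> \<noteq> pi / 2 \<and> (\<forall>s\<in>I. m (\<alpha> s) (N s) (Y (\<alpha> s)) = cos \<theta>)))"

definition sigma_N :: "(real \<Rightarrow> real) \<Rightarrow> (real \<Rightarrow> real) \<Rightarrow> real \<Rightarrow> real" where
  "sigma_N \<kappa> \<tau> s = ((\<kappa> s)\<^sup>2 + (\<tau> s)\<^sup>2) powr (3/2) / ((\<kappa> s)\<^sup>2 * deriv (\<lambda>t. \<tau> t / \<kappa> t) s)"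

end

theory Submission
  imports Defs
begin

text \<open>
  The statement is one about curves in Euclidean space, transported to the group. In the
  left-invariant orthonormal frame a field along \<open>\<alpha>\<close> is its coefficient curve in \<open>real ^ 3\<close>, the
  metric is the inner product, and left-invariant fields are the constant curves
  (\<open>metric_lincomb\<close>, \<open>lincomb_in_lie_algebra\<close>). In an Abelian group the covariant derivative is
  the plain derivative of the coefficients, because brackets of left-invariant fields vanish
  (\<open>abelian_lie_bracket_eq_0\<close>): if \<open>P\<close> and \<open>Q\<close> are represented at the neutral element by curves
  \<open>\<gamma>\<close> and \<open>\<delta>\<close>, then $P(Qf)$ and $Q(Pf)$ at \<open>p\<close> are the two mixed derivatives at \<open>(0, 0)\<close> of the
  single smooth function $f(p + \gamma(t) + \delta(r))$. So the Frenet equations become the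
  classical ones (\<open>abelian_frenet_frame\<close>), and it remains to show that the principal normal makes
  a constant angle, not a right one, with a fixed direction iff \<open>sigma_N\<close> is constant.

  Put $u = \tau/\varkappa$ and $q = \sqrt{1+u^2}$, so that
  $\sigma_N = \varkappa q^3/u'$. Suppose that $\langle N, y\rangle = c \neq 0$ for a constant vector
  \<open>y\<close>. Differentiating, one gets
  $\langle T, y\rangle = u\,\langle B, y\rangle$, and differentiating once more
  $u'\langle B,y\rangle = c\,\varkappa\,q^2$. Hence $u'$ has no zero, and
  $\sigma_N = \langle B,y\rangle\,q/c$, whose derivative is zero.
  Conversely, if $\sigma_N = C$ with $u' \neq 0$, the first argument says, up to sign, what the axis must be:
  $y = c\,(C\,(u/q)\,T + N + C\,(1/q)\,B)$ with $c = 1/\sqrt{1+C^2}$. The equation $\sigma_N = C$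
  gives $C\,(u/q)' = \varkappa$ and $C\,(1/q)' = -\tau$, and then the Frenet equations give
  $y' = 0$.
\<close>

section \<open>Calculus of $C^n$ maps\<close>

lemma Ck_on_subset: "Ck_on n S f \<Longrightarrow> T \<subseteq> S \<Longrightarrow> Ck_on n T f"
proof (induction n arbitrary: f)
  case 0 then show ?case by (auto intro: continuous_on_subset)
next
  case (Suc n) then show ?case by (fastforce)
qed

lemma Ck_on_Suc_imp: "Ck_on (Suc n) S f \<Longrightarrow> Ck_on n S f"
proof (induction n arbitrary: f)
  case 0
  then have "f differentiable_on S"
    unfolding differentiable_on_def by (simp add: differentiable_at_withinI)
  then show ?case by (simp add: differentiable_imp_continuous_on)
next
  case (Suc n)
  from Suc.prems have d: "\<forall>x\<in>S. f differentiable (at x)"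
    and "\<And>v. Ck_on (Suc n) S (\<lambda>x. frechet_derivative f (at x) v)" by auto
  then have "\<And>v. Ck_on n S (\<lambda>x. frechet_derivative f (at x) v)" using Suc.IH by blast
  with d show ?case by simp
qed

text \<open>Smoothness of a composite between manifolds is only known chart by chart, in a neighbourhood of
  each point; this glues the neighbourhoods.\<close>

lemma Ck_on_local:
  assumes "\<And>x. x \<in> S \<Longrightarrow> \<exists>U. open U \<and> x \<in> U \<and> Ck_on n U f"
  shows "Ck_on n S f"
  using assms
proof (induction n arbitrary: f)
  case 0
  show ?case unfolding Ck_on.simps continuous_on_eq_continuous_within
  proof
    fix x assume "x \<in> S"
    then obtain U where "open U" "x \<in> U" "continuous_on U f" using 0 by auto
    then have "continuous (at x) f" by (simp add: continuous_on_eq_continuous_at)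
    then show "continuous (at x within S) f" by (rule continuous_at_imp_continuous_at_within)
  qed
next
  case (Suc n)
  have "f differentiable (at x)" if "x \<in> S" for x
    using Suc.prems[OF that] by auto
  moreover have "Ck_on n S (\<lambda>x. frechet_derivative f (at x) v)" for v
    by (rule Suc.IH) (use Suc.prems in fastforce)
  ultimately show ?case by simp
qed

lemma Ck_on_cong:
  assumes "open S" "\<And>x. x \<in> S \<Longrightarrow> f x = g x" "Ck_on n S f"
  shows "Ck_on n S g"
  using assms(2,3)
proof (induction n arbitrary: f g)
  case 0 then show ?case by (auto cong: continuous_on_cong)
next
  case (Suc n)
  have fd: "f differentiable (at x)" if "x \<in> S" for x using Suc.prems that by auto
  have "g differentiable (at x)" if "x \<in> S" for x
  proof -
    from fd[OF that] obtain D where "(f has_derivative D) (at x)" unfolding differentiable_def ..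
    then have "(g has_derivative D) (at x)"
      by (rule has_derivative_transform_within_open[OF _ assms(1) that Suc.prems(1)])
    then show ?thesis by (auto simp: differentiable_def)
  qed
  moreover have "Ck_on n S (\<lambda>x. frechet_derivative g (at x) v)" for v
  proof (rule Suc.IH)
    show "Ck_on n S (\<lambda>x. frechet_derivative f (at x) v)" using Suc.prems by simp
    show "frechet_derivative f (at x) v = frechet_derivative g (at x) v" if "x \<in> S" for x
      using frechet_derivative_transform_within_open[OF fd[OF that] assms(1) that Suc.prems(1)] by simp
  qed
  ultimately show ?case by simp
qed

text \<open>Lets one prove \<open>Ck_on\<close> with any formula for the derivative in place of \<open>frechet_derivative\<close>.
  Openness of \<open>S\<close> enters because the derivatives of order at least two see values near a point.\<close>

lemma Ck_on_SucI:
  assumes "open S" "\<And>x. x \<in> S \<Longrightarrow> (f has_derivative D x) (at x)"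
    and "\<And>v. Ck_on n S (\<lambda>x. D x v)"
  shows "Ck_on (Suc n) S f"
proof -
  have "Ck_on n S (\<lambda>x. frechet_derivative f (at x) v)" for v
    by (rule Ck_on_cong[OF assms(1) _ assms(3)[of v]]) (use frechet_derivative_at[OF assms(2)] in auto)
  with assms(2) show ?thesis by (auto simp: differentiable_def)
qed

lemma Ck_on_SucD:
  assumes "Ck_on (Suc n) S f" "x \<in> S"
  shows "(f has_derivative frechet_derivative f (at x)) (at x)"
  using assms frechet_derivative_works by auto

lemma Ck_on_const: "Ck_on n S (\<lambda>x. c)"
  by (induction n arbitrary: c) auto

lemma Ck_on_bounded_linear:
  assumes "bounded_linear L" "open S" "Ck_on n S f"
  shows "Ck_on n S (\<lambda>x. L (f x))"
  using assms(3)
proof (induction n arbitrary: f)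
  case 0 then show ?case using assms by (auto intro: bounded_linear.continuous_on)
next
  case (Suc n)
  show ?case
  proof (rule Ck_on_SucI[OF assms(2)])
    show "((\<lambda>x. L (f x)) has_derivative (\<lambda>v. L (frechet_derivative f (at x) v))) (at x)"
      if "x \<in> S" for x
      using bounded_linear.has_derivative[OF assms(1) Ck_on_SucD[OF Suc.prems that]] .
    show "Ck_on n S (\<lambda>x. L (frechet_derivative f (at x) v))" for v
      using Suc by auto
  qed
qed

lemma Ck_on_add:
  assumes "open S" "Ck_on n S f" "Ck_on n S g"
  shows "Ck_on n S (\<lambda>x. f x + g x)"
  using assms(2,3)
proof (induction n arbitrary: f g)
  case 0 then show ?case by (auto intro: continuous_on_add)
next
  case (Suc n)
  show ?case
  proof (rule Ck_on_SucI[OF assms(1)])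
    show "((\<lambda>x. f x + g x) has_derivative
        (\<lambda>v. frechet_derivative f (at x) v + frechet_derivative g (at x) v)) (at x)"
      if "x \<in> S" for x
      using has_derivative_add[OF Ck_on_SucD[OF Suc.prems(1) that] Ck_on_SucD[OF Suc.prems(2) that]] .
    show "Ck_on n S (\<lambda>x. frechet_derivative f (at x) v + frechet_derivative g (at x) v)" for v
      using Suc by auto
  qed
qed

lemma Ck_on_sum:
  assumes "open S" "finite J" "\<And>i. i \<in> J \<Longrightarrow> Ck_on n S (f i)"
  shows "Ck_on n S (\<lambda>x. \<Sum>i\<in>J. f i x)"
  using assms(2,3)
  by (induction J rule: finite_induct) (auto intro: Ck_on_const Ck_on_add[OF assms(1)])

lemma Ck_on_scaleR:
  assumes "open S" "Ck_on n S f" "Ck_on n S g"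
  shows "Ck_on n S (\<lambda>x. f x *\<^sub>R g x)"
  using assms(2,3)
proof (induction n arbitrary: f g)
  case 0 then show ?case by (auto intro: continuous_on_scaleR)
next
  case (Suc n)
  show ?case
  proof (rule Ck_on_SucI[OF assms(1)])
    show "((\<lambda>x. f x *\<^sub>R g x) has_derivative
        (\<lambda>v. f x *\<^sub>R frechet_derivative g (at x) v + frechet_derivative f (at x) v *\<^sub>R g x)) (at x)"
      if "x \<in> S" for x
      using has_derivative_scaleR[OF Ck_on_SucD[OF Suc.prems(1) that] Ck_on_SucD[OF Suc.prems(2) that]] .
    show "Ck_on n S (\<lambda>x. f x *\<^sub>R frechet_derivative g (at x) v + frechet_derivative f (at x) v *\<^sub>R g x)" for v
    proof (rule Ck_on_add[OF assms(1)])
      show "Ck_on n S (\<lambda>x. f x *\<^sub>R frechet_derivative g (at x) v)"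
        using Suc.prems by (intro Suc.IH Ck_on_Suc_imp[of n S f]) simp_all
      show "Ck_on n S (\<lambda>x. frechet_derivative f (at x) v *\<^sub>R g x)"
        using Suc.prems by (intro Suc.IH Ck_on_Suc_imp[of n S g]) simp_all
    qed
  qed
qed

text \<open>The directional derivatives of \<open>g \<circ> f\<close> are $\sum_b \langle Df(x)v, b\rangle\, Dg(f(x))b$ over a
  basis. Only the fixed directions \<open>b\<close> occur in \<open>Dg\<close>, as \<open>Ck_on\<close> requires, so the induction
  hypothesis applies to each \<open>Dg(\<cdot>)b\<close> and products and sums do the rest.\<close>

lemma Ck_on_compose:
  fixes f :: "'a::real_normed_vector \<Rightarrow> 'b::euclidean_space"
  assumes "open S" "f ` S \<subseteq> T" "Ck_on n S f" "Ck_on n T g"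
  shows "Ck_on n S (\<lambda>x. g (f x))"
  using assms(3,4)
proof (induction n arbitrary: g)
  case 0
  then show ?case using continuous_on_compose2[OF _ _ assms(2)] by auto
next
  case (Suc n)
  let ?Df = "\<lambda>x. frechet_derivative f (at x)" and ?Dg = "\<lambda>x. frechet_derivative g (at x)"
  show ?case
  proof (rule Ck_on_SucI[OF assms(1)])
    fix x assume x: "x \<in> S"
    with assms(2) have Dg: "(g has_derivative ?Dg (f x)) (at (f x))"
      by (intro Ck_on_SucD[OF Suc.prems(2)]) auto
    have lin: "linear (?Dg (f x))" by (rule has_derivative_linear[OF Dg])
    have "?Dg (f x) (?Df x v) = (\<Sum>b\<in>Basis. (?Df x v \<bullet> b) *\<^sub>R ?Dg (f x) b)" for v
      using linear_sum[OF lin, of "\<lambda>b. (?Df x v \<bullet> b) *\<^sub>R b" Basis]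
      by (simp add: linear_scale[OF lin] euclidean_representation)
    moreover have "((\<lambda>x. g (f x)) has_derivative (\<lambda>v. ?Dg (f x) (?Df x v))) (at x)"
      by (rule has_derivative_compose[OF Ck_on_SucD[OF Suc.prems(1) x] Dg])
    ultimately show "((\<lambda>x. g (f x)) has_derivative
        (\<lambda>v. \<Sum>b\<in>Basis. (?Df x v \<bullet> b) *\<^sub>R ?Dg (f x) b)) (at x)"
      by (simp only:)
  next
    fix v
    have "Ck_on n S (\<lambda>x. ?Dg (f x) b)" for b
      using Suc.prems(2) by (intro Suc.IH Ck_on_Suc_imp[OF Suc.prems(1)]) simp
    moreover have "Ck_on n S (\<lambda>x. ?Df x v \<bullet> b)" for b
      using Suc.prems(1) by (intro Ck_on_bounded_linear[OF bounded_linear_inner_left assms(1)]) simp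
    ultimately show "Ck_on n S (\<lambda>x. \<Sum>b\<in>Basis. (?Df x v \<bullet> b) *\<^sub>R ?Dg (f x) b)"
      by (intro Ck_on_sum Ck_on_scaleR assms(1) finite_Basis)
  qed
qed

lemma Ck_on_Pair:
  assumes "open S" "Ck_on n S f" "Ck_on n S g"
  shows "Ck_on n S (\<lambda>x. (f x, g x))"
proof -
  have "Ck_on n S (\<lambda>x. (f x, 0) + (0, g x))"
  proof (rule Ck_on_add[OF assms(1)])
    show "Ck_on n S (\<lambda>x. (f x, 0))"
      by (rule Ck_on_bounded_linear[OF _ assms(1,2)])
        (intro bounded_linear_Pair bounded_linear_ident bounded_linear_zero)
    show "Ck_on n S (\<lambda>x. (0, g x))"
      by (rule Ck_on_bounded_linear[OF _ assms(1,3)])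
        (intro bounded_linear_Pair bounded_linear_ident bounded_linear_zero)
  qed
  then show ?thesis by simp
qed

section \<open>Smooth maps between manifolds and into Lie groups\<close>

text \<open>The part of \<open>smooth_atlas\<close> on which composition of smooth maps depends. Unlike \<open>smooth_atlas\<close>, it
  passes to product atlases without any argument on transition maps.\<close>

definition topological_atlas :: "('g::topological_space, 'e::euclidean_space) atlas \<Rightarrow> bool" where
  "topological_atlas A \<longleftrightarrow> (\<Union>(U, \<phi>)\<in>A. U) = UNIV \<and>
     (\<forall>(U, \<phi>)\<in>A. open U \<and> inj_on \<phi> U \<and> (\<forall>W\<subseteq>U. open W \<longrightarrow> open (\<phi> ` W)))"

lemma topological_atlasD:
  assumes "topological_atlas A"
  shows "\<exists>(U, \<phi>)\<in>A. x \<in> U"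
    and "(U, \<phi>) \<in> A \<Longrightarrow> open U"
    and "(U, \<phi>) \<in> A \<Longrightarrow> inj_on \<phi> U"
    and "(U, \<phi>) \<in> A \<Longrightarrow> W \<subseteq> U \<Longrightarrow> open W \<Longrightarrow> open (\<phi> ` W)"
  using assms unfolding topological_atlas_def by (fastforce simp: set_eq_iff)+

lemma smooth_imp_topological_atlas:
  assumes "smooth_atlas A"
  shows "topological_atlas A"
proof -
  have "inj_on \<phi> U \<and> (\<forall>W\<subseteq>U. open W \<longrightarrow> open (\<phi> ` W))" if "(U, \<phi>) \<in> A" for U \<phi>
  proof -
    from assms that have o: "open U" "open (\<phi> ` U)" and h: "homeomorphism U (\<phi> ` U) \<phi> (inv_into U \<phi>)"
      unfolding smooth_atlas_def by auto
    have "open (\<phi> ` W)" if "W \<subseteq> U" "open W" for W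
      using homeomorphism_imp_open_map[OF h, of W] o that
      by (metis openin_open_eq)
    moreover have "inj_on \<phi> U" using h by (metis homeomorphism_def inj_on_inverseI)
    ultimately show ?thesis by blast
  qed
  with assms show ?thesis unfolding smooth_atlas_def topological_atlas_def by auto
qed

lemma topological_atlas_std: "topological_atlas std_atlas"
  unfolding topological_atlas_def std_atlas_def by auto

lemma topological_atlas_prod:
  fixes A :: "('a::topological_space, 'b::euclidean_space) atlas"
    and B :: "('c::topological_space, 'd::euclidean_space) atlas"
  assumes A: "topological_atlas A" and B: "topological_atlas B"
  shows "topological_atlas (prod_atlas A B)"
proof -
  have image_open: "open (map_prod \<phi> \<psi> ` W)"
    if U: "(U, \<phi>) \<in> A" and V: "(V, \<psi>) \<in> B" and W: "W \<subseteq> U \<times> V" "open W" for U \<phi> V \<psi> W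
  proof (rule Topological_Spaces.openI)
    fix z assume "z \<in> map_prod \<phi> \<psi> ` W"
    then obtain x y where xy: "(x, y) \<in> W" "z = (\<phi> x, \<psi> y)" by auto
    obtain P Q where PQ: "open P" "open Q" "(x, y) \<in> P \<times> Q" "P \<times> Q \<subseteq> W"
      using open_prod_elim[OF W(2) xy(1)] by (metis mem_Times_iff)
    then have sub: "P \<subseteq> U" "Q \<subseteq> V" using W(1) by auto
    have "open (\<phi> ` P \<times> \<psi> ` Q)"
      using topological_atlasD(4)[OF A U sub(1) PQ(1)] topological_atlasD(4)[OF B V sub(2) PQ(2)]
      by (rule open_Times)
    moreover have "z \<in> \<phi> ` P \<times> \<psi> ` Q" "\<phi> ` P \<times> \<psi> ` Q \<subseteq> map_prod \<phi> \<psi> ` W"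
      using PQ(3,4) xy(2) by (auto simp: image_iff)
    ultimately show "\<exists>T. open T \<and> z \<in> T \<and> T \<subseteq> map_prod \<phi> \<psi> ` W"
      by (intro exI[of _ "\<phi> ` P \<times> \<psi> ` Q"] conjI)
  qed
  moreover have "(\<Union>(W, \<zeta>)\<in>prod_atlas A B. W) = UNIV"
  proof (intro set_eqI iffI UNIV_I)
    fix p :: "'a \<times> 'c"
    obtain U \<phi> where U: "(U, \<phi>) \<in> A" "fst p \<in> U" using topological_atlasD(1)[OF A] by blast
    obtain V \<psi> where V: "(V, \<psi>) \<in> B" "snd p \<in> V" using topological_atlasD(1)[OF B] by blast
    have "(U \<times> V, map_prod \<phi> \<psi>) \<in> prod_atlas A B" using U V unfolding prod_atlas_def by blast
    moreover have "p \<in> U \<times> V" using U V by (simp add: mem_Times_iff)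
    ultimately show "p \<in> (\<Union>(W, \<zeta>)\<in>prod_atlas A B. W)" by blast
  qed
  moreover have "open W \<and> inj_on \<zeta> W \<and> (\<forall>R\<subseteq>W. open R \<longrightarrow> open (\<zeta> ` R))"
    if "(W, \<zeta>) \<in> prod_atlas A B" for W \<zeta>
  proof -
    from that obtain U \<phi> V \<psi> where U: "(U, \<phi>) \<in> A" and V: "(V, \<psi>) \<in> B"
      and W: "W = U \<times> V" "\<zeta> = map_prod \<phi> \<psi>" unfolding prod_atlas_def by blast
    have "open W"
      unfolding W using topological_atlasD(2)[OF A U] topological_atlasD(2)[OF B V] by (rule open_Times)
    moreover have "inj_on \<zeta> W"
      unfolding W using topological_atlasD(3)[OF A U] topological_atlasD(3)[OF B V] by (rule map_prod_inj_on)
    ultimately show ?thesis using image_open[OF U V] W by simp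
  qed
  ultimately show ?thesis
    unfolding topological_atlas_def by blast
qed

lemma smooth_map_onD:
  assumes "smooth_map_on S A B f"
  shows "open S" "continuous_on S f"
    and "(U, \<phi>) \<in> A \<Longrightarrow> (V, \<psi>) \<in> B \<Longrightarrow> Ck_on n (\<phi> ` (S \<inter> U \<inter> f -` V)) (\<lambda>x. \<psi> (f (inv_into U \<phi> x)))"
  using assms unfolding smooth_map_on_def smooth_on_def comp_def by (auto dest!: bspec)

lemma smooth_map_onI:
  assumes "open S" "continuous_on S f"
    and "\<And>U \<phi> V \<psi> n. (U, \<phi>) \<in> A \<Longrightarrow> (V, \<psi>) \<in> B \<Longrightarrow>
      Ck_on n (\<phi> ` (S \<inter> U \<inter> f -` V)) (\<lambda>x. \<psi> (f (inv_into U \<phi> x)))"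
  shows "smooth_map_on S A B f"
  using assms unfolding smooth_map_on_def smooth_on_def comp_def by auto

text \<open>Near a point one inserts a chart of the middle manifold around its image and composes the two
  coordinate representations there.\<close>

lemma smooth_map_on_compose:
  assumes A: "topological_atlas A" and B: "topological_atlas B" and C: "topological_atlas C"
    and f: "smooth_map_on S A B f" and g: "smooth_map_on T B C g"
  shows "smooth_map_on (S \<inter> f -` T) A C (\<lambda>x. g (f x))"
proof (rule smooth_map_onI)
  note cf = smooth_map_onD(1,2)[OF f] and cg = smooth_map_onD(1,2)[OF g]
  have pre: "open (S \<inter> f -` W)" if "open W" for W
    using continuous_open_preimage[OF cf(2,1) that] .
  show "open (S \<inter> f -` T)" using pre[OF cg(1)] .
  show "continuous_on (S \<inter> f -` T) (\<lambda>x. g (f x))"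
    by (rule continuous_on_compose2[OF cg(2) continuous_on_subset[OF cf(2)]]) auto
  fix U \<phi> W \<zeta> n assume U: "(U, \<phi>) \<in> A" and W: "(W, \<zeta>) \<in> C"
  note inj = topological_atlasD(3)[OF A U]
  show "Ck_on n (\<phi> ` (S \<inter> f -` T \<inter> U \<inter> (\<lambda>x. g (f x)) -` W)) (\<lambda>x. \<zeta> (g (f (inv_into U \<phi> x))))"
  proof (rule Ck_on_local)
    fix z assume "z \<in> \<phi> ` (S \<inter> f -` T \<inter> U \<inter> (\<lambda>x. g (f x)) -` W)"
    then obtain x where x: "z = \<phi> x" "x \<in> S" "f x \<in> T" "x \<in> U" "g (f x) \<in> W" by auto
    obtain V \<psi> where V: "(V, \<psi>) \<in> B" and xV: "f x \<in> V" using topological_atlasD(1)[OF B, of "f x"] by auto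
    let ?R = "T \<inter> V \<inter> g -` W" and ?Q = "S \<inter> U \<inter> f -` (T \<inter> V \<inter> g -` W)"
    have "open ?R"
      using open_Int[OF continuous_open_preimage[OF cg(2,1) topological_atlasD(2)[OF C W]]
          topological_atlasD(2)[OF B V]] by (simp add: Int_ac)
    then have "open ((S \<inter> f -` ?R) \<inter> U)"
      by (rule open_Int[OF pre topological_atlasD(2)[OF A U]])
    also have "(S \<inter> f -` ?R) \<inter> U = ?Q" by blast
    finally have "open ?Q" .
    then have o: "open (\<phi> ` ?Q)" by (intro topological_atlasD(4)[OF A U]) auto
    have "Ck_on n (\<phi> ` ?Q) (\<lambda>x. \<psi> (f (inv_into U \<phi> x)))"
      by (rule Ck_on_subset[OF smooth_map_onD(3)[OF f U V]]) auto
    moreover have "Ck_on n (\<psi> ` ?R) (\<lambda>y. \<zeta> (g (inv_into V \<psi> y)))"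
      by (rule smooth_map_onD(3)[OF g V W])
    moreover have "(\<lambda>x. \<psi> (f (inv_into U \<phi> x))) ` \<phi> ` ?Q \<subseteq> \<psi> ` ?R"
      by (auto simp: inv_into_f_f[OF inj])
    ultimately have "Ck_on n (\<phi> ` ?Q) (\<lambda>x. \<zeta> (g (inv_into V \<psi> (\<psi> (f (inv_into U \<phi> x))))))"
      using Ck_on_compose[OF o] by blast
    then have "Ck_on n (\<phi> ` ?Q) (\<lambda>x. \<zeta> (g (f (inv_into U \<phi> x))))"
    proof (rule Ck_on_cong[OF o, rotated])
      fix w assume "w \<in> \<phi> ` ?Q"
      then obtain q where "w = \<phi> q" "q \<in> U" "f q \<in> V" by auto
      then show "\<zeta> (g (inv_into V \<psi> (\<psi> (f (inv_into U \<phi> w))))) = \<zeta> (g (f (inv_into U \<phi> w)))"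
        by (simp add: inv_into_f_f[OF inj] inv_into_f_f[OF topological_atlasD(3)[OF B V]])
    qed
    moreover have "z \<in> \<phi> ` ?Q" using x xV by auto
    ultimately show "\<exists>X. open X \<and> z \<in> X \<and> Ck_on n X (\<lambda>x. \<zeta> (g (f (inv_into U \<phi> x))))"
      using o by blast
  qed
qed

lemma smooth_map_on_Pair:
  assumes A: "topological_atlas A" and B: "topological_atlas B" and C: "topological_atlas C"
    and f: "smooth_map_on S A B f" and g: "smooth_map_on S A C g"
  shows "smooth_map_on S A (prod_atlas B C) (\<lambda>x. (f x, g x))"
proof (rule smooth_map_onI)
  note cf = smooth_map_onD(1,2)[OF f] and cg = smooth_map_onD(1,2)[OF g]
  show "open S" by (rule cf(1))
  show "continuous_on S (\<lambda>x. (f x, g x))" using cf cg by (intro continuous_on_Pair)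
  fix U \<phi> W \<zeta> n assume U: "(U, \<phi>) \<in> A" and "(W, \<zeta>) \<in> prod_atlas B C"
  then obtain V1 \<psi>1 V2 \<psi>2 where V: "(V1, \<psi>1) \<in> B" "(V2, \<psi>2) \<in> C"
    and W: "W = V1 \<times> V2" "\<zeta> = map_prod \<psi>1 \<psi>2" unfolding prod_atlas_def by auto
  let ?Q = "S \<inter> U \<inter> (\<lambda>x. (f x, g x)) -` W"
  have "open ((S \<inter> f -` V1) \<inter> (S \<inter> g -` V2) \<inter> U)"
    using continuous_open_preimage[OF cf(2,1) topological_atlasD(2)[OF B V(1)]]
      continuous_open_preimage[OF cg(2,1) topological_atlasD(2)[OF C V(2)]]
      topological_atlasD(2)[OF A U] by (simp only: open_Int)
  moreover have "(S \<inter> f -` V1) \<inter> (S \<inter> g -` V2) \<inter> U = ?Q" using W by auto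
  ultimately have o: "open (\<phi> ` ?Q)" by (intro topological_atlasD(4)[OF A U]) auto
  have "Ck_on n (\<phi> ` ?Q) (\<lambda>x. \<psi>1 (f (inv_into U \<phi> x)))"
    by (rule Ck_on_subset[OF smooth_map_onD(3)[OF f U V(1)]]) (use W in auto)
  moreover have "Ck_on n (\<phi> ` ?Q) (\<lambda>x. \<psi>2 (g (inv_into U \<phi> x)))"
    by (rule Ck_on_subset[OF smooth_map_onD(3)[OF g U V(2)]]) (use W in auto)
  ultimately have "Ck_on n (\<phi> ` ?Q) (\<lambda>x. (\<psi>1 (f (inv_into U \<phi> x)), \<psi>2 (g (inv_into U \<phi> x))))"
    by (rule Ck_on_Pair[OF o])
  then show "Ck_on n (\<phi> ` ?Q) (\<lambda>x. \<zeta> (f (inv_into U \<phi> x), g (inv_into U \<phi> x)))"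
    by (simp add: W)
qed

lemma smooth_map_on_subset:
  assumes "smooth_map_on S A B f" "open T" "T \<subseteq> S"
  shows "smooth_map_on T A B f"
proof (rule smooth_map_onI)
  show "continuous_on T f" using smooth_map_onD(2)[OF assms(1)] assms(3) by (rule continuous_on_subset)
  show "Ck_on n (\<phi> ` (T \<inter> U \<inter> f -` V)) (\<lambda>x. \<psi> (f (inv_into U \<phi> x)))"
    if "(U, \<phi>) \<in> A" "(V, \<psi>) \<in> B" for U \<phi> V \<psi> n
    by (rule Ck_on_subset[OF smooth_map_onD(3)[OF assms(1) that]]) (use assms(3) in auto)
qed (rule assms(2))

lemma smooth_map_on_const: "open S \<Longrightarrow> smooth_map_on S A B (\<lambda>x. c)"
  by (rule smooth_map_onI) (auto intro: Ck_on_const)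

lemma smooth_map_on_std_iff:
  "smooth_map_on S std_atlas std_atlas f \<longleftrightarrow> open S \<and> smooth_on S f"
proof -
  have "inv_into UNIV (\<lambda>x. x) = (\<lambda>x::'a. x)"
    using inv_id by (simp add: id_def)
  moreover have "smooth_on S f \<Longrightarrow> continuous_on S f"
    unfolding smooth_on_def by (metis Ck_on.simps(1))
  ultimately show ?thesis by (auto simp: smooth_map_on_def std_atlas_def comp_def)
qed

lemma smooth_map_on_bounded_linear:
  assumes "open S" "bounded_linear L"
  shows "smooth_map_on S std_atlas std_atlas L"
proof -
  have "Ck_on n S L" for n
  proof (cases n)
    case 0
    with assms(2) show ?thesis by (simp add: linear_continuous_on)
  next
    case (Suc k)
    have "Ck_on (Suc k) S L"
      by (rule Ck_on_SucI[OF assms(1) bounded_linear_imp_has_derivative[OF assms(2)] Ck_on_const])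
    with Suc show ?thesis by simp
  qed
  with assms(1) show ?thesis by (simp add: smooth_map_on_std_iff smooth_on_def)
qed

lemma smooth_map_on_add:
  fixes A :: "('g::{group_add,t2_space,second_countable_topology}, 'e::euclidean_space) atlas"
  assumes A: "lie_group A" and D: "topological_atlas D"
    and f: "smooth_map_on S D A f" and g: "smooth_map_on S D A g"
  shows "smooth_map_on S D A (\<lambda>x. f x + g x)"
proof -
  have tA: "topological_atlas A" and p: "smooth_map_on UNIV (prod_atlas A A) A (\<lambda>(x, y). x + y)"
    using A smooth_imp_topological_atlas unfolding lie_group_def by auto
  from smooth_map_on_compose[OF D topological_atlas_prod[OF tA tA] tA smooth_map_on_Pair[OF D tA tA f g] p]
  show ?thesis by simp
qed

section \<open>Symmetry of second derivatives\<close>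

text \<open>Relates derivatives along curves, which is what \<open>velocity\<close> sees, to the total derivative.\<close>

lemma DERIV_chain_vector:
  assumes "(c has_vector_derivative v) (at t)" "(F has_derivative D) (at (c t))"
  shows "((\<lambda>t. F (c t)) has_real_derivative D v) (at t)"
proof -
  have "linear D" using assms(2) by (rule has_derivative_linear)
  then have "(\<lambda>h. D (h *\<^sub>R v)) = (*) (D v)" by (auto simp: linear_scale)
  moreover have "((\<lambda>t. F (c t)) has_derivative (\<lambda>h. D (h *\<^sub>R v))) (at t)"
    using has_derivative_compose[OF assms(1)[unfolded has_vector_derivative_def] assms(2)] .
  ultimately show ?thesis by (simp add: has_field_derivative_def)
qed

text \<open>Two applications of the mean value theorem, first in \<open>t\<close> and then in \<open>r\<close>. The left-hand side
  does not change when the roles of \<open>t\<close> and \<open>r\<close> are exchanged, which is what makes mixed partial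
  derivatives agree.\<close>

lemma second_difference_mvt:
  fixes F F1 F12 :: "real \<Rightarrow> real \<Rightarrow> real"
  assumes h: "h > 0"
    and F1: "\<And>t r. t \<in> {a..a+h} \<Longrightarrow> r \<in> {b..b+h} \<Longrightarrow> ((\<lambda>t. F t r) has_real_derivative F1 t r) (at t)"
    and F12: "\<And>t r. t \<in> {a..a+h} \<Longrightarrow> r \<in> {b..b+h} \<Longrightarrow> (F1 t has_real_derivative F12 t r) (at r)"
  obtains t r where "t \<in> {a..a+h}" "r \<in> {b..b+h}"
    "F (a+h) (b+h) - F (a+h) b - F a (b+h) + F a b = h * h * F12 t r"
proof -
  have "\<exists>t>a. t < a + h \<and> (F (a+h) (b+h) - F (a+h) b) - (F a (b+h) - F a b) = (a + h - a) * (F1 t (b+h) - F1 t b)"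
    using h by (intro MVT2) (auto intro!: DERIV_diff F1)
  then obtain t where "a < t" "t < a + h" and
    eq: "(F (a+h) (b+h) - F (a+h) b) - (F a (b+h) - F a b) = (a + h - a) * (F1 t (b+h) - F1 t b)"
    by blast
  then have t: "t \<in> {a..a+h}" by simp
  have "\<exists>r>b. r < b + h \<and> F1 t (b+h) - F1 t b = (b + h - b) * F12 t r"
    using h by (intro MVT2) (auto intro!: F12 t)
  then obtain r where "b < r" "r < b + h" and eq': "F1 t (b+h) - F1 t b = (b + h - b) * F12 t r"
    by blast
  then have "r \<in> {b..b+h}" by simp
  moreover have "F (a+h) (b+h) - F (a+h) b - F a (b+h) + F a b = h * h * F12 t r"
    using eq eq' by simp
  ultimately show thesis by (rule that[OF t])
qed

text \<open>The second difference over a small square with corner \<open>(a, b)\<close> is $h^2$ times a value of \<open>F12\<close>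
  and also $h^2$ times a value of \<open>F21\<close>, at points of the square; shrinking the square and using
  continuity at the corner, the two functions agree there.\<close>

theorem mixed_partials_eq:
  fixes F F1 F2 F12 F21 :: "real \<Rightarrow> real \<Rightarrow> real"
  assumes S: "open S" "(a, b) \<in> S"
    and F1: "\<And>t r. (t, r) \<in> S \<Longrightarrow> ((\<lambda>t. F t r) has_real_derivative F1 t r) (at t)"
    and F2: "\<And>t r. (t, r) \<in> S \<Longrightarrow> (F t has_real_derivative F2 t r) (at r)"
    and F12: "\<And>t r. (t, r) \<in> S \<Longrightarrow> (F1 t has_real_derivative F12 t r) (at r)"
    and F21: "\<And>t r. (t, r) \<in> S \<Longrightarrow> ((\<lambda>t. F2 t r) has_real_derivative F21 t r) (at t)"
    and c12: "continuous (at (a, b)) (\<lambda>(t, r). F12 t r)"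
    and c21: "continuous (at (a, b)) (\<lambda>(t, r). F21 t r)"
  shows "F12 a b = F21 a b"
proof (rule ccontr)
  assume "F12 a b \<noteq> F21 a b"
  then have e: "dist (F12 a b) (F21 a b) / 2 > 0" (is "?e > 0") by simp
  obtain d0 where d0: "d0 > 0" "ball (a, b) d0 \<subseteq> S" using S open_contains_ball by blast
  obtain d1 where d1: "d1 > 0" "\<And>x. dist x (a, b) < d1 \<Longrightarrow> dist (case x of (t, r) \<Rightarrow> F12 t r) (F12 a b) < ?e"
    using c12 e unfolding continuous_at_eps_delta by (metis case_prod_conv)
  obtain d2 where d2: "d2 > 0" "\<And>x. dist x (a, b) < d2 \<Longrightarrow> dist (case x of (t, r) \<Rightarrow> F21 t r) (F21 a b) < ?e"
    using c21 e unfolding continuous_at_eps_delta by (metis case_prod_conv)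
  \<comment> \<open>The far corner of the square is at distance less than \<open>2 * h\<close>, whence the factor 3.\<close>
  define h where "h = min d0 (min d1 d2) / 3"
  have h: "h > 0" "2 * h < d0" "2 * h < d1" "2 * h < d2"
    using d0(1) d1(1) d2(1) unfolding h_def by (auto simp: min_def)
  have near: "dist (t, r) (a, b) \<le> 2 * h" if "t \<in> {a..a+h}" "r \<in> {b..b+h}" for t r
  proof -
    have "dist (t, r) (a, b) \<le> dist t a + dist r b"
      unfolding dist_Pair_Pair by (rule sqrt_sum_squares_le_sum) auto
    also have "\<dots> \<le> 2 * h" using that by (auto simp: dist_real_def)
    finally show ?thesis .
  qed
  then have inS: "(t, r) \<in> S" if "t \<in> {a..a+h}" "r \<in> {b..b+h}" for t r
  proof -
    have "dist (t, r) (a, b) < d0" using near[OF that] h(2) by linarith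
    then show ?thesis using d0(2) by (auto simp: dist_commute)
  qed
  obtain t r where tr: "t \<in> {a..a+h}" "r \<in> {b..b+h}"
    "F (a+h) (b+h) - F (a+h) b - F a (b+h) + F a b = h * h * F12 t r"
    by (rule second_difference_mvt[of h a b F F1 F12, OF h(1) F1[OF inS] F12[OF inS]])
  obtain r' t' where tr': "r' \<in> {b..b+h}" "t' \<in> {a..a+h}"
    "F (a+h) (b+h) - F a (b+h) - F (a+h) b + F a b = h * h * F21 t' r'"
    by (rule second_difference_mvt[of h b a "\<lambda>r t. F t r" "\<lambda>r t. F2 t r" "\<lambda>r t. F21 t r",
          OF h(1) F2[OF inS] F21[OF inS]])
  have "F12 t r = F21 t' r'" using tr(3) tr'(3) h(1) by (simp add: algebra_simps)
  moreover have "dist (F12 t r) (F12 a b) < ?e" using d1(2)[of "(t, r)"] near[OF tr(1,2)] h by simp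
  moreover have "dist (F21 t' r') (F21 a b) < ?e" using d2(2)[of "(t', r')"] near[OF tr'(2,1)] h by simp
  ultimately show False
    using dist_triangle2[of "F12 a b" "F21 a b" "F12 t r"] by (simp add: dist_commute)
qed

corollary Ck_on_mixed_derivs_eq:
  fixes F :: "real \<times> real \<Rightarrow> real"
  assumes S: "open S" "(a, b) \<in> S" and F: "Ck_on 2 S F"
  shows "deriv (\<lambda>t. deriv (\<lambda>r. F (t, r)) b) a = deriv (\<lambda>r. deriv (\<lambda>t. F (t, r)) a) b"
proof -
  define D where "D x v = frechet_derivative F (at x) v" for x v
  define D2 where "D2 x v w = frechet_derivative (\<lambda>y. D y v) (at x) w" for x v w
  have F': "Ck_on (Suc (Suc 0)) S F" using F by (simp add: numeral_2_eq_2)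
  have C1: "Ck_on (Suc 0) S (\<lambda>x. D x v)" for v using F' unfolding D_def Ck_on.simps(2)[of "Suc 0"] by blast
  have F1: "(F has_derivative D x) (at x)" if "x \<in> S" for x
    using Ck_on_SucD[OF F' that] unfolding D_def .
  have D1: "((\<lambda>x. D x v) has_derivative D2 x v) (at x)" if "x \<in> S" for x v
    using Ck_on_SucD[OF C1 that] unfolding D2_def .
  have cont: "continuous (at (a, b)) (\<lambda>x. D2 x v w)" for v w
  proof -
    have "continuous_on S (\<lambda>x. D2 x v w)" using C1[of v] unfolding D2_def Ck_on.simps by blast
    then show ?thesis using S by (simp add: continuous_on_eq_continuous_at)
  qed
  have left: "((\<lambda>t. (t, r)) has_vector_derivative (1, 0)) (at t)"
    and right: "((\<lambda>r. (t, r)) has_vector_derivative (0, 1)) (at r)" for t r :: real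
    by (auto intro!: derivative_eq_intros has_vector_derivative_Pair)
  note d = DERIV_chain_vector[OF left F1] DERIV_chain_vector[OF right F1]
    DERIV_chain_vector[OF left D1] DERIV_chain_vector[OF right D1]
  have eq: "D2 (a, b) (1, 0) (0, 1) = D2 (a, b) (0, 1) (1, 0)"
    using mixed_partials_eq[OF S, of "\<lambda>t r. F (t, r)" "\<lambda>t r. D (t, r) (1, 0)" "\<lambda>t r. D (t, r) (0, 1)"
        "\<lambda>t r. D2 (t, r) (1, 0) (0, 1)" "\<lambda>t r. D2 (t, r) (0, 1) (1, 0)"] d cont
    by (simp add: case_prod_unfold)
  have o: "open ((\<lambda>t. (t, b)) -` S)" "open ((\<lambda>r. (a, r)) -` S)"
    by (intro open_vimage S(1) continuous_intros)+
  have "((\<lambda>t. deriv (\<lambda>r. F (t, r)) b) has_real_derivative D2 (a, b) (0, 1) (1, 0)) (at a)"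
    by (rule has_field_derivative_transform_within_open[OF d(3)[OF S(2)] o(1)])
      (use S DERIV_imp_deriv[OF d(2)] in auto)
  moreover have "((\<lambda>r. deriv (\<lambda>t. F (t, r)) a) has_real_derivative D2 (a, b) (1, 0) (0, 1)) (at b)"
    by (rule has_field_derivative_transform_within_open[OF d(4)[OF S(2)] o(2)])
      (use S DERIV_imp_deriv[OF d(1)] in auto)
  ultimately show ?thesis using eq by (metis DERIV_imp_deriv)
qed

section \<open>Left-invariant fields and their bracket\<close>

lemma smooth_map_on_ident:
  assumes "smooth_atlas A"
  shows "smooth_map_on UNIV A A (\<lambda>x. x)"
  using assms unfolding smooth_map_on_def smooth_atlas_def comp_def
  by (auto simp: vimage_def)

lemma smooth_fun_comp:
  assumes "topological_atlas D" "topological_atlas A" "smooth_map_on S D A G" "smooth_fun A f"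
  shows "smooth_map_on S D std_atlas (\<lambda>x. f (G x))"
  using smooth_map_on_compose[OF assms(1,2) topological_atlas_std assms(3,4)] by simp

lemma lie_group_topological_atlas: "lie_group A \<Longrightarrow> topological_atlas A"
  by (simp add: lie_group_def smooth_imp_topological_atlas)

lemma smooth_fun_left_translate:
  fixes A :: "('g::{group_add,t2_space,second_countable_topology}, 'e::euclidean_space) atlas"
  assumes "lie_group A" "smooth_fun A f"
  shows "smooth_fun A (\<lambda>x. f (g + x))"
proof -
  note tA = lie_group_topological_atlas[OF assms(1)]
  have "smooth_map_on UNIV A A (\<lambda>x. g + x)"
    using assms(1) by (intro smooth_map_on_add tA smooth_map_on_const smooth_map_on_ident)
      (auto simp: lie_group_def)
  then show ?thesis by (rule smooth_fun_comp[OF tA tA _ assms(2)])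
qed

text \<open>The two-parameter surface spanned by two curves. Its mixed derivatives give the bracket of two
  left-invariant fields, and its restriction to a line through the origin realises a linear
  combination of two tangent vectors by a curve.\<close>

lemma smooth_map_on_curve_sum:
  fixes A :: "('g::{group_add,t2_space,second_countable_topology}, 'e::euclidean_space) atlas"
    and \<gamma> \<delta> :: "real \<Rightarrow> 'g"
  assumes A: "lie_group A" and \<gamma>: "smooth_map_on S std_atlas A \<gamma>" and \<delta>: "smooth_map_on R std_atlas A \<delta>"
  shows "smooth_map_on (S \<times> R) std_atlas A (\<lambda>x. \<gamma> (fst x) + (q + \<delta> (snd x)))"
proof -
  note tA = lie_group_topological_atlas[OF A] and tS = topological_atlas_std
  have o: "open (S \<times> R)" using smooth_map_onD(1)[OF \<gamma>] smooth_map_onD(1)[OF \<delta>] by (rule open_Times)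
  have "smooth_map_on (S \<times> R) std_atlas A (\<lambda>x. \<gamma> (fst x))"
    using smooth_map_on_compose[OF tS tS tA smooth_map_on_bounded_linear[OF open_UNIV bounded_linear_fst] \<gamma>]
    by (rule smooth_map_on_subset[OF _ o]) auto
  moreover have "smooth_map_on (S \<times> R) std_atlas A (\<lambda>x. \<delta> (snd x))"
    using smooth_map_on_compose[OF tS tS tA smooth_map_on_bounded_linear[OF open_UNIV bounded_linear_snd] \<delta>]
    by (rule smooth_map_on_subset[OF _ o]) auto
  ultimately show ?thesis
    by (intro smooth_map_on_add[OF A tS] smooth_map_on_const o)
qed

lemma tangent_spaceE:
  assumes "u \<in> tangent_space A p"
  obtains \<gamma> S where "u = velocity A \<gamma> 0" "\<gamma> 0 = p" "0 \<in> S" "smooth_map_on S std_atlas A \<gamma>"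
proof -
  from assms obtain \<gamma> \<epsilon> where "u = velocity A \<gamma> 0" "\<gamma> 0 = p" "\<epsilon> > 0"
    "smooth_map_on {-\<epsilon><..<\<epsilon>} std_atlas A \<gamma>" unfolding tangent_space_def by blast
  then show thesis by (intro that[of \<gamma> "{-\<epsilon><..<\<epsilon>}"]) auto
qed

lemma tangent_spaceI:
  assumes "\<gamma> 0 = p" "0 \<in> S" "smooth_map_on S std_atlas A \<gamma>"
  shows "velocity A \<gamma> 0 \<in> tangent_space A p"
proof -
  obtain e where e: "e > 0" "ball 0 e \<subseteq> S"
    using smooth_map_onD(1)[OF assms(3)] assms(2) open_contains_ball by blast
  have "smooth_map_on {-e<..<e} std_atlas A \<gamma>"
    using e(2) by (intro smooth_map_on_subset[OF assms(3)]) (auto simp: ball_eq_greaterThanLessThan)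
  with assms(1) e(1) show ?thesis unfolding tangent_space_def by blast
qed

text \<open>Tangent vectors are velocities of curves, so a linear combination must be realised by a curve. The
  group operation provides one without charts: $\gamma(at) - p + \delta(bt)$, where \<open>\<gamma>\<close> and \<open>\<delta>\<close>
  pass through \<open>p\<close> with velocities \<open>u\<close> and \<open>v\<close>.\<close>

lemma tangent_space_lincomb2:
  fixes A :: "('g::{group_add,t2_space,second_countable_topology}, 'e::euclidean_space) atlas"
  assumes A: "lie_group A" and u: "u \<in> tangent_space A p" and v: "v \<in> tangent_space A p"
  shows "(\<lambda>f. a * u f + b * v f) \<in> tangent_space A p"
proof -
  note tA = lie_group_topological_atlas[OF A] and tS = topological_atlas_std
  obtain \<gamma> S where \<gamma>: "u = velocity A \<gamma> 0" "\<gamma> 0 = p" "0 \<in> S" "smooth_map_on S std_atlas A \<gamma>"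
    using u by (rule tangent_spaceE)
  obtain \<delta> R where \<delta>: "v = velocity A \<delta> 0" "\<delta> 0 = p" "0 \<in> R" "smooth_map_on R std_atlas A \<delta>"
    using v by (rule tangent_spaceE)
  define G where "G x = \<gamma> (fst x) + (- p + \<delta> (snd x))" for x
  have G: "smooth_map_on (S \<times> R) std_atlas A G"
    unfolding G_def using A \<gamma>(4) \<delta>(4) by (rule smooth_map_on_curve_sum)
  define L where "L t = (a * t, b * t)" for t :: real
  have L: "bounded_linear L" unfolding L_def
    by (intro bounded_linear_Pair bounded_linear_const_mult bounded_linear_ident)
  have "smooth_map_on (UNIV \<inter> L -` (S \<times> R)) std_atlas A (\<lambda>t. G (L t))"
    by (rule smooth_map_on_compose[OF tS tS tA smooth_map_on_bounded_linear[OF open_UNIV L] G])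
  moreover have "0 \<in> UNIV \<inter> L -` (S \<times> R)" "G (L 0) = p"
    using \<gamma> \<delta> by (simp_all add: L_def G_def)
  ultimately have ts: "velocity A (\<lambda>t. G (L t)) 0 \<in> tangent_space A p"
    by (intro tangent_spaceI)
  have "velocity A (\<lambda>t. G (L t)) 0 f = a * u f + b * v f" for f
  proof (cases "smooth_fun A f")
    case True
    from smooth_fun_comp[OF tS tA G True] have "Ck_on (Suc 0) (S \<times> R) (\<lambda>x. f (G x))"
      unfolding smooth_map_on_std_iff smooth_on_def by blast
    then obtain D where D: "((\<lambda>x. f (G x)) has_derivative D) (at (0, 0))"
      using Ck_on_SucD \<gamma>(3) \<delta>(3) by blast
    have line: "deriv (\<lambda>t. f (G (c * t, d * t))) 0 = D (c, d)" for c d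
    proof (rule DERIV_imp_deriv)
      have "((\<lambda>t. (c * t, d * t)) has_vector_derivative (c, d)) (at 0)"
        by (auto intro!: derivative_eq_intros has_vector_derivative_Pair)
      from DERIV_chain_vector[OF this, of "\<lambda>x. f (G x)" D] D
      show "((\<lambda>t. f (G (c * t, d * t))) has_real_derivative D (c, d)) (at 0)" by simp
    qed
    have lin: "linear D" using D by (rule has_derivative_linear)
    have "D (a, b) = D (a *\<^sub>R (1, 0) + b *\<^sub>R (0, 1))" by simp
    also have "\<dots> = a * D (1, 0) + b * D (0, 1)"
      by (simp only: linear_add[OF lin] linear_scale[OF lin] real_scaleR_def)
    finally have "D (a, b) = a * D (1, 0) + b * D (0, 1)" .
    moreover have "u f = D (1, 0)" "v f = D (0, 1)"
      using line[of 1 0] line[of 0 1] True \<gamma>(1,2) \<delta>(1,2) by (simp_all add: velocity_def G_def)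
    ultimately show ?thesis using True line[of a b] by (simp add: velocity_def L_def)
  next
    case False
    then show ?thesis using \<gamma>(1) \<delta>(1) by (simp add: velocity_def)
  qed
  then have "velocity A (\<lambda>t. G (L t)) 0 = (\<lambda>f. a * u f + b * v f)" by (rule ext)
  with ts show ?thesis by (simp only:)
qed

lemma tangent_space_sum:
  fixes A :: "('g::{group_add,t2_space,second_countable_topology}, 'e::euclidean_space) atlas"
  assumes A: "lie_group A" and J: "finite J" and u: "\<And>i. u i \<in> tangent_space A p"
  shows "(\<lambda>f. \<Sum>i\<in>J. c i * u i f) \<in> tangent_space A p"
  using J
proof induction
  case empty
  show ?case using tangent_space_lincomb2[OF A u u, of 0 _ 0] by simp
next
  case (insert i J)
  show ?case using tangent_space_lincomb2[OF A u[of i] insert.IH, of "c i" 1] insert.hyps by simp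
qed

lemma riemannian_metric_linear:
  assumes "riemannian_metric A m" "u \<in> tangent_space A p" "v \<in> tangent_space A p" "w \<in> tangent_space A p"
  shows "m p (\<lambda>f. a * u f + b * v f) w = a * m p u w + b * m p v w"
  using assms unfolding riemannian_metric_def by (elim conjE) simp

lemma metric_sum_left:
  fixes A :: "('g::{group_add,t2_space,second_countable_topology}, 'e::euclidean_space) atlas"
  assumes A: "lie_group A" and m: "riemannian_metric A m" and J: "finite J"
    and u: "\<And>i. u i \<in> tangent_space A p" and w: "w \<in> tangent_space A p"
  shows "m p (\<lambda>f. \<Sum>i\<in>J. c i * u i f) w = (\<Sum>i\<in>J. c i * m p (u i) w)"
  using J
proof induction
  case empty
  have "m p (\<lambda>f. 0 * w f + 0 * w f) w = 0 * m p w w + 0 * m p w w"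
    by (rule riemannian_metric_linear[OF m w w w])
  then show ?case by simp
next
  case (insert i J)
  let ?s = "\<lambda>f. \<Sum>i\<in>J. c i * u i f"
  have "m p (\<lambda>f. c i * u i f + 1 * ?s f) w = c i * m p (u i) w + 1 * m p ?s w"
    by (rule riemannian_metric_linear[OF m u tangent_space_sum[OF A insert.hyps(1) u] w])
  then show ?case using insert by simp
qed

lemma orthonormal_basis_in_tangent_space:
  "orthonormal_basis A m X \<Longrightarrow> X i p \<in> tangent_space A p"
  by (simp add: orthonormal_basis_def lie_algebra_def smooth_vector_field_def)

lemma lincomb_in_tangent_space:
  fixes A :: "('g::{group_add,t2_space,second_countable_topology}, 'e::euclidean_space) atlas"
  assumes "lie_group A" "orthonormal_basis A m X"
  shows "lincomb X p c \<in> tangent_space A p"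
  unfolding lincomb_def
  using tangent_space_sum[OF assms(1) finite orthonormal_basis_in_tangent_space[OF assms(2)]] .

lemma metric_lincomb:
  fixes A :: "('g::{group_add,t2_space,second_countable_topology}, 'e::euclidean_space) atlas"
  assumes A: "lie_group A" and m: "riemannian_metric A m" and X: "orthonormal_basis A m X"
  shows "m p (lincomb X p c) (lincomb X p d) = c \<bullet> d"
proof -
  note ts = orthonormal_basis_in_tangent_space[OF X] lincomb_in_tangent_space[OF A X]
  have left: "m p (lincomb X p c) w = (\<Sum>i\<in>UNIV. c $ i * m p (X i p) w)"
    if "w \<in> tangent_space A p" for c w
    unfolding lincomb_def by (rule metric_sum_left[OF A m finite ts(1) that])
  have sym: "m p u v = m p v u" if "u \<in> tangent_space A p" "v \<in> tangent_space A p" for u v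
    using m that unfolding riemannian_metric_def by blast
  have "m p (X i p) (lincomb X p d) = d $ i" for i
  proof -
    have "m p (X i p) (lincomb X p d) = m p (lincomb X p d) (X i p)" by (rule sym[OF ts])
    also have "\<dots> = (\<Sum>j\<in>UNIV. d $ j * (if j = i then 1 else 0))"
      using X by (simp add: left[OF ts(1)] orthonormal_basis_def)
    finally show ?thesis by (simp add: if_distrib[of "(*) _"] cong: if_cong)
  qed
  then show ?thesis by (simp add: left[OF ts(2)] inner_vec_def)
qed

lemma coeffs_lincomb:
  fixes A :: "('g::{group_add,t2_space,second_countable_topology}, 'e::euclidean_space) atlas"
  assumes A: "lie_group A" and m: "riemannian_metric A m" and X: "orthonormal_basis A m X"
    and W: "W s = lincomb X (\<alpha> s) c"
  shows "coeffs m X \<alpha> W s = c"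
proof -
  have "X i (\<alpha> s) = lincomb X (\<alpha> s) (axis i 1)" for i
    by (simp add: lincomb_def axis_def if_distrib[of "\<lambda>z. z * _"] cong: if_cong)
  then have "m (\<alpha> s) (W s) (X i (\<alpha> s)) = c $ i" for i
    using metric_lincomb[OF A m X, of "\<alpha> s" c "axis i 1"] W by (simp add: inner_axis)
  then show ?thesis by (simp add: coeffs_def vec_eq_iff)
qed

lemma smooth_fun_sum:
  assumes A: "topological_atlas A" and f: "\<And>i. i \<in> J \<Longrightarrow> smooth_fun A (f i)" and J: "finite J"
  shows "smooth_fun A (\<lambda>x. \<Sum>i\<in>J. c i * f i x)"
proof (rule smooth_map_onI)
  show "continuous_on UNIV (\<lambda>x. \<Sum>i\<in>J. c i * f i x)"
    using smooth_map_onD(2)[OF f] by (intro continuous_intros)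
  fix U \<phi> and V :: "real set" and \<psi> n assume U: "(U, \<phi>) \<in> A" and "(V, \<psi>) \<in> std_atlas"
  then have V: "V = UNIV" "\<psi> = (\<lambda>x. x)" by (auto simp: std_atlas_def)
  have o: "open (\<phi> ` U)" using topological_atlasD(2,4)[OF A U] by blast
  have "Ck_on n (\<phi> ` U) (\<lambda>x. f i (inv_into U \<phi> x))" if "i \<in> J" for i
    using smooth_map_onD(3)[OF f[OF that] U, of UNIV "\<lambda>x. x" n] by (simp add: std_atlas_def)
  then have "Ck_on n (\<phi> ` U) (\<lambda>x. \<Sum>i\<in>J. c i *\<^sub>R f i (inv_into U \<phi> x))"
    by (intro Ck_on_sum Ck_on_scaleR Ck_on_const o J)
  then show "Ck_on n (\<phi> ` (UNIV \<inter> U \<inter> (\<lambda>x. \<Sum>i\<in>J. c i * f i x) -` V))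
      (\<lambda>x. \<psi> (\<Sum>i\<in>J. c i * f i (inv_into U \<phi> x)))"
    by (simp add: V)
qed simp

lemma lincomb_in_lie_algebra:
  fixes A :: "('g::{group_add,t2_space,second_countable_topology}, 'e::euclidean_space) atlas"
  assumes A: "lie_group A" and X: "orthonormal_basis A m X"
  shows "(\<lambda>p. lincomb X p c) \<in> lie_algebra A"
proof -
  have XA: "X i \<in> lie_algebra A" for i using X by (simp add: orthonormal_basis_def)
  have "smooth_fun A (\<lambda>p. lincomb X p c f)" if "smooth_fun A f" for f
    unfolding lincomb_def using XA that
    by (intro smooth_fun_sum lie_group_topological_atlas[OF A])
      (auto simp: lie_algebra_def smooth_vector_field_def)
  moreover have "lincomb X (g + p) c = pushforward (\<lambda>x. g + x) (lincomb X p c)" for g p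
  proof -
    have "X i (g + p) f = X i p (f \<circ> (\<lambda>x. g + x))" for i f
      using XA[of i] by (simp add: lie_algebra_def pushforward_def)
    then show ?thesis by (simp add: lincomb_def pushforward_def)
  qed
  ultimately show ?thesis
    using lincomb_in_tangent_space[OF A X] by (simp add: lie_algebra_def smooth_vector_field_def)
qed

text \<open>A single curve through the neutral element represents the field at every point, by translation.\<close>

lemma left_invariant_apply:
  fixes A :: "('g::{group_add,t2_space,second_countable_topology}, 'e::euclidean_space) atlas"
  assumes A: "lie_group A" and P: "P \<in> lie_algebra A" "P 0 = velocity A \<gamma> 0" and f: "smooth_fun A f"
  shows "P q f = deriv (\<lambda>t. f (q + \<gamma> t)) 0"
proof -
  have "P (q + 0) = pushforward (\<lambda>x. q + x) (P 0)" using P(1) unfolding lie_algebra_def by blast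
  then show ?thesis
    using smooth_fun_left_translate[OF A f] by (simp add: pushforward_def P(2) velocity_def comp_def)
qed

text \<open>With curves \<open>\<gamma>\<close> and \<open>\<delta>\<close> through the neutral element that represent \<open>P\<close> and \<open>Q\<close>, iterating the
  fields gives derivatives of $f(p+\gamma(t)+\delta(r))$ and of $f(p+\delta(r)+\gamma(t))$. By
  commutativity this is one function, and its second derivatives commute.\<close>

lemma abelian_lie_bracket_eq_0:
  fixes A :: "('g::{ab_group_add,t2_space,second_countable_topology}, 'e::euclidean_space) atlas"
  assumes A: "lie_group A" and P: "P \<in> lie_algebra A" and Q: "Q \<in> lie_algebra A"
  shows "lie_bracket P Q p = (\<lambda>f. 0)"
proof
  fix f
  note tA = lie_group_topological_atlas[OF A] and tS = topological_atlas_std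
  have ts: "P q \<in> tangent_space A q" "Q q \<in> tangent_space A q" for q
    using P Q by (auto simp: lie_algebra_def smooth_vector_field_def)
  show "lie_bracket P Q p f = 0"
  proof (cases "smooth_fun A f")
    case True
    obtain \<gamma> S where \<gamma>: "P 0 = velocity A \<gamma> 0" "\<gamma> 0 = 0" "0 \<in> S" "smooth_map_on S std_atlas A \<gamma>"
      using ts(1) by (rule tangent_spaceE)
    obtain \<delta> R where \<delta>: "Q 0 = velocity A \<delta> 0" "\<delta> 0 = 0" "0 \<in> R" "smooth_map_on R std_atlas A \<delta>"
      using ts(2) by (rule tangent_spaceE)
    define F where "F x = f (\<gamma> (fst x) + (p + \<delta> (snd x)))" for x
    have "smooth_map_on (S \<times> R) std_atlas std_atlas F"
      unfolding F_def by (rule smooth_fun_comp[OF tS tA smooth_map_on_curve_sum[OF A \<gamma>(4) \<delta>(4)] True])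
    then have "open (S \<times> R)" "Ck_on 2 (S \<times> R) F"
      unfolding smooth_map_on_std_iff smooth_on_def by auto
    moreover have "(0, 0) \<in> S \<times> R" using \<gamma> \<delta> by simp
    ultimately have comm: "deriv (\<lambda>t. deriv (\<lambda>r. F (t, r)) 0) 0 = deriv (\<lambda>r. deriv (\<lambda>t. F (t, r)) 0) 0"
      by (intro Ck_on_mixed_derivs_eq)
    have sm: "smooth_fun A (\<lambda>q. P q f)" "smooth_fun A (\<lambda>q. Q q f)"
      using P Q True by (auto simp: lie_algebra_def smooth_vector_field_def)
    note eP = left_invariant_apply[OF A P \<gamma>(1)] and eQ = left_invariant_apply[OF A Q \<delta>(1)]
    have "P p (\<lambda>q. Q q f) = deriv (\<lambda>t. Q (p + \<gamma> t) f) 0" by (rule eP[OF sm(2)])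
    also have "\<dots> = deriv (\<lambda>t. deriv (\<lambda>r. F (t, r)) 0) 0"
      by (simp add: eQ[OF True] F_def add_ac)
    finally have PQ: "P p (\<lambda>q. Q q f) = deriv (\<lambda>t. deriv (\<lambda>r. F (t, r)) 0) 0" .
    have "Q p (\<lambda>q. P q f) = deriv (\<lambda>r. P (p + \<delta> r) f) 0" by (rule eQ[OF sm(1)])
    also have "\<dots> = deriv (\<lambda>r. deriv (\<lambda>t. F (t, r)) 0) 0"
      by (simp add: eP[OF True] F_def add_ac)
    finally have QP: "Q p (\<lambda>q. P q f) = deriv (\<lambda>r. deriv (\<lambda>t. F (t, r)) 0) 0" .
    from comm PQ QP show ?thesis by (simp add: lie_bracket_def)
  next
    case False
    \<comment> \<open>A tangent vector is 0 on a function that is not smooth, so here both inner functions vanish.\<close>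
    have zero: "u g = 0" if "u \<in> tangent_space A q" "\<not> smooth_fun A g \<or> g = (\<lambda>x. 0)" for u q g
      using that by (auto simp: tangent_space_def velocity_def)
    show ?thesis using zero[OF ts(1)] zero[OF ts(2)] False by (simp add: lie_bracket_def)
  qed
qed

lemma abelian_cov_deriv_along:
  fixes A :: "('g::{ab_group_add,t2_space,second_countable_topology}, 'e::euclidean_space) atlas"
  assumes A: "lie_group A" and X: "orthonormal_basis A m X"
  shows "cov_deriv_along m X \<alpha> T W s = dot_along m X \<alpha> W s"
  using abelian_lie_bracket_eq_0[OF A lincomb_in_lie_algebra[OF A X] lincomb_in_lie_algebra[OF A X]]
  by (simp add: cov_deriv_along_def bracket_along_def)

section \<open>Slant helices in an inner product space\<close>

lemma one_plus_square_pos: "1 + (x::real)\<^sup>2 > 0"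
  by (smt (verit) zero_le_power2)

text \<open>A Frenet frame in an abstract inner product space. Orthonormality stands in for the cross product,
  because all that follows only takes inner products of the frame vectors and their derivatives.\<close>

locale frenet_frame =
  fixes I :: "real set" and t n b :: "real \<Rightarrow> 'a::real_inner" and \<kappa> \<tau> :: "real \<Rightarrow> real"
  assumes I: "open I" "convex I" "I \<noteq> {}"
    and t_deriv: "s \<in> I \<Longrightarrow> (t has_vector_derivative \<kappa> s *\<^sub>R n s) (at s)"
    and n_deriv: "s \<in> I \<Longrightarrow> (n has_vector_derivative - \<kappa> s *\<^sub>R t s + \<tau> s *\<^sub>R b s) (at s)"
    and b_deriv: "s \<in> I \<Longrightarrow> (b has_vector_derivative - \<tau> s *\<^sub>R n s) (at s)"
    and unit: "s \<in> I \<Longrightarrow> t s \<bullet> t s = 1" "s \<in> I \<Longrightarrow> n s \<bullet> n s = 1" "s \<in> I \<Longrightarrow> b s \<bullet> b s = 1"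
    and orth: "s \<in> I \<Longrightarrow> t s \<bullet> n s = 0" "s \<in> I \<Longrightarrow> t s \<bullet> b s = 0" "s \<in> I \<Longrightarrow> n s \<bullet> b s = 0"
    and \<kappa>_pos: "s \<in> I \<Longrightarrow> \<kappa> s > 0"
    and quotient_differentiable: "s \<in> I \<Longrightarrow> (\<lambda>r. \<tau> r / \<kappa> r) field_differentiable (at s)"
begin

definition ratio :: "real \<Rightarrow> real" where "ratio s = \<tau> s / \<kappa> s"

lemma ratio_deriv: "s \<in> I \<Longrightarrow> (ratio has_real_derivative deriv ratio s) (at s)"
  using quotient_differentiable[of s] unfolding ratio_def[abs_def] by (simp add: DERIV_deriv_iff_field_differentiable)

lemma \<tau>_eq: "s \<in> I \<Longrightarrow> \<tau> s = ratio s * \<kappa> s"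
  using \<kappa>_pos[of s] by (simp add: ratio_def)

lemma sqrt_ratio_deriv:
  assumes "s \<in> I"
  shows "((\<lambda>s. sqrt (1 + (ratio s)\<^sup>2)) has_real_derivative ratio s * deriv ratio s / sqrt (1 + (ratio s)\<^sup>2)) (at s)"
  using one_plus_square_pos[of "ratio s"] one_plus_square_pos[of "ratio s", THEN less_imp_neq]
  by (auto intro!: derivative_eq_intros ratio_deriv assms simp: field_simps)

lemma sigma_N_eq:
  assumes "s \<in> I"
  shows "sigma_N \<kappa> \<tau> s = \<kappa> s * (1 + (ratio s)\<^sup>2) * sqrt (1 + (ratio s)\<^sup>2) / deriv ratio s"
proof -
  let ?x = "(\<kappa> s)\<^sup>2 + (\<tau> s)\<^sup>2"
  have x: "?x = (\<kappa> s)\<^sup>2 * (1 + (ratio s)\<^sup>2)"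
    using \<tau>_eq[OF assms] by (simp add: algebra_simps power_mult_distrib)
  have pos: "?x > 0" unfolding x using \<kappa>_pos[OF assms] one_plus_square_pos by simp
  have "?x powr (3/2) = ?x powr (1 + 1/2)" by simp
  also have "\<dots> = ?x * sqrt ?x" using pos by (simp only: powr_add powr_half_sqrt powr_one less_imp_le)
  also have "sqrt ?x = \<kappa> s * sqrt (1 + (ratio s)\<^sup>2)"
    unfolding x using \<kappa>_pos[OF assms] by (simp add: real_sqrt_mult)
  finally have "?x powr (3/2) = (\<kappa> s)\<^sup>2 * (\<kappa> s * (1 + (ratio s)\<^sup>2) * sqrt (1 + (ratio s)\<^sup>2))"
    unfolding x by (simp add: mult_ac)
  then show ?thesis
    using \<kappa>_pos[OF assms] unfolding sigma_N_def ratio_def[abs_def, symmetric] by simp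
qed

lemma inner_deriv:
  assumes "(f has_vector_derivative v) (at s)"
  shows "((\<lambda>s. f s \<bullet> y) has_real_derivative v \<bullet> y) (at s)"
  using bounded_linear.has_vector_derivative[OF bounded_linear_inner_left assms]
  by (simp add: has_real_derivative_iff_has_vector_derivative)

text \<open>Differentiating \<open>n \<bullet> y = c\<close> gives \<open>t \<bullet> y = ratio * (b \<bullet> y)\<close>, and differentiating this gives
  the formula \<open>key\<close> below for the derivative of \<open>ratio\<close>. It turns \<open>sigma_N\<close> into a multiple of
  \<open>(b \<bullet> y) * sqrt (1 + ratio^2)\<close>, and it also makes the derivative of that product vanish.\<close>

lemma constant_normal_component_imp:
  assumes y: "\<And>s. s \<in> I \<Longrightarrow> n s \<bullet> y = c" and c: "c \<noteq> 0"
  shows "\<forall>s\<in>I. deriv ratio s \<noteq> 0" and "\<exists>C. \<forall>s\<in>I. sigma_N \<kappa> \<tau> s = C"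
proof -
  have t': "((\<lambda>s. t s \<bullet> y) has_real_derivative \<kappa> s * c) (at s)" if "s \<in> I" for s
    using inner_deriv[OF t_deriv[OF that], of y] y[OF that] by simp
  have b': "((\<lambda>s. b s \<bullet> y) has_real_derivative - \<tau> s * c) (at s)" if "s \<in> I" for s
    using inner_deriv[OF b_deriv[OF that], of y] y[OF that] by simp
  have tb: "t s \<bullet> y = ratio s * (b s \<bullet> y)" if "s \<in> I" for s
  proof -
    have const: "((\<lambda>s. n s \<bullet> y) has_real_derivative 0) (at s)"
      by (rule has_field_derivative_transform_within_open[OF DERIV_const I(1) that]) (use y in auto)
    have "\<kappa> s * (t s \<bullet> y) = \<tau> s * (b s \<bullet> y)"
      using DERIV_unique[OF inner_deriv[OF n_deriv[OF that], of y] const] by (simp add: inner_simps)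
    then show ?thesis using \<kappa>_pos[OF that] by (simp add: ratio_def field_simps)
  qed
  have key: "deriv ratio s * (b s \<bullet> y) = c * \<kappa> s * (1 + (ratio s)\<^sup>2)" if s: "s \<in> I" for s
  proof -
    have "((\<lambda>s. ratio s * (b s \<bullet> y)) has_real_derivative deriv ratio s * (b s \<bullet> y) + - \<tau> s * c * ratio s) (at s)"
      by (rule DERIV_mult[OF ratio_deriv[OF s] b'[OF s]])
    then have "((\<lambda>s. t s \<bullet> y) has_real_derivative deriv ratio s * (b s \<bullet> y) + - \<tau> s * c * ratio s) (at s)"
      by (rule has_field_derivative_transform_within_open[OF _ I(1) s]) (use tb in auto)
    from DERIV_unique[OF this t'[OF s]] show ?thesis
      by (simp add: \<tau>_eq[OF s] algebra_simps power2_eq_square)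
  qed
  have nonzero: "deriv ratio s \<noteq> 0" "b s \<bullet> y \<noteq> 0" if "s \<in> I" for s
    using key[OF that] c \<kappa>_pos[OF that] one_plus_square_pos[of "ratio s"] by auto
  then show "\<forall>s\<in>I. deriv ratio s \<noteq> 0" by blast
  define w where "w s = (b s \<bullet> y) * sqrt (1 + (ratio s)\<^sup>2) / c" for s
  have "(w has_real_derivative 0) (at s)" if s: "s \<in> I" for s
  proof -
    let ?q = "sqrt (1 + (ratio s)\<^sup>2)"
    have q: "?q > 0" "?q * ?q = 1 + (ratio s)\<^sup>2" using one_plus_square_pos[of "ratio s"] by auto
    have "(w has_real_derivative
        (- \<tau> s * c * ?q + ratio s * deriv ratio s / ?q * (b s \<bullet> y)) / c) (at s)"
      unfolding w_def[abs_def] by (intro DERIV_cdivide DERIV_mult b' sqrt_ratio_deriv s)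
    moreover have "ratio s * deriv ratio s / ?q * (b s \<bullet> y) = \<tau> s * c * ?q"
    proof -
      have "ratio s * deriv ratio s * (b s \<bullet> y) = \<tau> s * c * (?q * ?q)"
        using key[OF s] unfolding q(2) \<tau>_eq[OF s] by (simp add: mult_ac)
      then show ?thesis using q(1) by (simp add: field_simps)
    qed
    ultimately show ?thesis by simp
  qed
  then have "\<exists>C. \<forall>s\<in>I. w s = C"
    by (intro has_field_derivative_zero_constant I(2)) (blast intro: has_field_derivative_at_within)
  moreover have "sigma_N \<kappa> \<tau> s = w s" if s: "s \<in> I" for s
  proof -
    have "\<kappa> s * (1 + (ratio s)\<^sup>2) = deriv ratio s * (b s \<bullet> y) / c" using key[OF s] c by simp
    then show ?thesis using nonzero[OF s] by (simp add: sigma_N_eq[OF s] w_def)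
  qed
  ultimately show "\<exists>C. \<forall>s\<in>I. sigma_N \<kappa> \<tau> s = C" by auto
qed

text \<open>The axis is written down in the moving frame with the coefficients that the converse implication
  forces on it up to sign, and then shown to be constant.\<close>

lemma constant_sigma_N_imp:
  assumes nonzero: "\<And>s. s \<in> I \<Longrightarrow> deriv ratio s \<noteq> 0" and sigma: "\<And>s. s \<in> I \<Longrightarrow> sigma_N \<kappa> \<tau> s = C"
  obtains y c where "norm y = 1" "0 < c" "c \<le> 1" "\<forall>s\<in>I. n s \<bullet> y = c"
proof -
  define q where "q s = sqrt (1 + (ratio s)\<^sup>2)" for s
  have q: "q s > 0" "q s * q s = 1 + (ratio s)\<^sup>2" for s
    using one_plus_square_pos[of "ratio s"] by (auto simp: q_def)
  have C: "C * deriv ratio s = \<kappa> s * (q s * q s) * q s" if "s \<in> I" for s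
    using sigma_N_eq[OF that] sigma[OF that] nonzero[OF that] by (simp add: q(2)) (simp add: q_def)
  define c where "c = 1 / sqrt (1 + C\<^sup>2)"
  have c: "c > 0" "c \<le> 1" using one_plus_square_pos[of C] by (simp_all add: c_def)
  have c2: "c * c * (1 + C\<^sup>2) = 1"
    using one_plus_square_pos[of C] by (simp add: c_def)
  define Y where "Y s = (c * C * (ratio s / q s)) *\<^sub>R t s + c *\<^sub>R n s + (c * C * (1 / q s)) *\<^sub>R b s" for s
  have Y': "(Y has_vector_derivative 0) (at s)" if s: "s \<in> I" for s
  proof -
    have q': "(q has_real_derivative ratio s * deriv ratio s / q s) (at s)"
      unfolding q_def[abs_def] by (rule sqrt_ratio_deriv[OF s])
    \<comment> \<open>The quotient rule for \<open>ratio / q\<close> and \<open>1 / q\<close>; the hypothesis on \<open>sigma_N\<close> turns the results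
      into \<open>\<kappa> / C\<close> and \<open>- \<tau> / C\<close>.\<close>
    let ?d = "(deriv ratio s * q s - ratio s * (ratio s * deriv ratio s / q s)) / (q s * q s)"
    let ?e = "(0 * q s - 1 * (ratio s * deriv ratio s / q s)) / (q s * q s)"
    have "?d = deriv ratio s * (q s * q s - (ratio s)\<^sup>2) / (q s * q s * q s)"
      using q(1)[of s] by (simp add: field_simps power2_eq_square)
    also have "\<dots> = deriv ratio s / (q s * q s * q s)" by (simp add: q(2))
    finally have "C * ?d = C * deriv ratio s / (q s * q s * q s)" by simp
    also have "\<dots> = \<kappa> s" unfolding C[OF s] using q(1)[of s] by simp
    finally have d: "c * C * ?d = c * \<kappa> s" by (simp only: mult.assoc)
    have uq: "((\<lambda>s. c * C * (ratio s / q s)) has_real_derivative c * \<kappa> s) (at s)"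
      unfolding d[symmetric] using q(1)[of s] by (intro DERIV_cmult DERIV_divide ratio_deriv q' s) simp
    have "C * ?e = - ratio s * (C * deriv ratio s) / (q s * q s * q s)"
      using q(1)[of s] by (simp add: field_simps)
    also have "\<dots> = - \<tau> s" unfolding C[OF s] \<tau>_eq[OF s] using q(1)[of s] by simp
    finally have e: "c * C * ?e = - c * \<tau> s" by (simp only: mult.assoc mult_minus_left mult_minus_right)
    have oq: "((\<lambda>s. c * C * (1 / q s)) has_real_derivative - c * \<tau> s) (at s)"
      unfolding e[symmetric] using q(1)[of s] by (intro DERIV_cmult DERIV_divide DERIV_const q') simp
    have "(Y has_vector_derivative
        ((c * C * (ratio s / q s)) *\<^sub>R (\<kappa> s *\<^sub>R n s) + (c * \<kappa> s) *\<^sub>R t s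
          + c *\<^sub>R (- \<kappa> s *\<^sub>R t s + \<tau> s *\<^sub>R b s)
          + ((c * C * (1 / q s)) *\<^sub>R (- \<tau> s *\<^sub>R n s) + (- c * \<tau> s) *\<^sub>R b s))) (at s)"
      unfolding Y_def[abs_def]
      by (intro has_vector_derivative_add has_vector_derivative_scaleR uq oq t_deriv b_deriv s
          bounded_linear.has_vector_derivative[OF bounded_linear_scaleR_right] n_deriv)
    moreover have "((c * C * (ratio s / q s)) *\<^sub>R (\<kappa> s *\<^sub>R n s) + (c * \<kappa> s) *\<^sub>R t s
          + c *\<^sub>R (- \<kappa> s *\<^sub>R t s + \<tau> s *\<^sub>R b s)
          + ((c * C * (1 / q s)) *\<^sub>R (- \<tau> s *\<^sub>R n s) + (- c * \<tau> s) *\<^sub>R b s)) = 0"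
      by (simp add: \<tau>_eq[OF s] algebra_simps)
    ultimately show ?thesis by simp
  qed
  have "\<exists>y. \<forall>s\<in>I. Y s = y"
    by (rule has_vector_derivative_zero_constant[OF I(2) has_vector_derivative_at_within[OF Y']]) blast+
  then obtain y where y: "\<And>s. s \<in> I \<Longrightarrow> Y s = y" by blast
  obtain s0 where s0: "s0 \<in> I" using I(3) by blast
  have nY: "n s \<bullet> y = c" if "s \<in> I" for s
    unfolding y[OF that, symmetric] Y_def
    using unit[OF that] orth[OF that] by (simp add: inner_simps inner_commute)
  have "y \<bullet> y = c * c * (1 + C\<^sup>2 * (((ratio s0)\<^sup>2 + 1) / (q s0 * q s0)))"
    unfolding y[OF s0, symmetric] Y_def
    using unit[OF s0] orth[OF s0] q(1)[of s0]
    by (simp add: inner_simps inner_commute field_simps power2_eq_square)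
  also have "\<dots> = 1" using c2 one_plus_square_pos[of "ratio s0"] by (simp add: q(2) add.commute)
  finally have "norm y = 1" by (simp add: norm_eq_sqrt_inner)
  with that[of y c] c nY show thesis by blast
qed

lemma slant_helix_iff_constant_sigma_N:
  "(\<exists>y. norm y = 1 \<and> (\<exists>\<theta>\<in>{0..pi}. \<theta> \<noteq> pi / 2 \<and> (\<forall>s\<in>I. n s \<bullet> y = cos \<theta>))) \<longleftrightarrow>
    (\<forall>s\<in>I. deriv (\<lambda>r. \<tau> r / \<kappa> r) s \<noteq> 0) \<and> (\<exists>C. \<forall>s\<in>I. sigma_N \<kappa> \<tau> s = C)" (is "?L \<longleftrightarrow> ?R")
proof
  assume ?L
  then obtain y \<theta> where \<theta>: "\<theta> \<in> {0..pi}" "\<theta> \<noteq> pi / 2" and y: "\<And>s. s \<in> I \<Longrightarrow> n s \<bullet> y = cos \<theta>"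
    by blast
  have "cos \<theta> \<noteq> 0" using cos_inj_pi[of \<theta> "pi / 2"] \<theta> by auto
  from constant_normal_component_imp[OF y this] show ?R unfolding ratio_def[abs_def] by blast
next
  assume ?R
  then obtain C where "\<And>s. s \<in> I \<Longrightarrow> deriv ratio s \<noteq> 0" "\<And>s. s \<in> I \<Longrightarrow> sigma_N \<kappa> \<tau> s = C"
    unfolding ratio_def[abs_def] by blast
  then obtain y c where y: "norm y = 1" and c: "0 < c" "c \<le> 1" and n: "\<forall>s\<in>I. n s \<bullet> y = c"
    by (rule constant_sigma_N_imp)
  have "cos (arccos c) = c" "arccos c \<in> {0..pi}" using c by (auto intro: arccos_lbound arccos_ubound)
  moreover from this(1) have "arccos c \<noteq> pi / 2" using c(1) by (metis cos_pi_half less_irrefl)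
  ultimately show ?L using y n by (intro exI[of _ y] conjI bexI[of _ "arccos c"]) auto
qed

end


section \<open>From the Lie group to coordinates\<close>

lemma lincomb_inject:
  fixes A :: "('g::{group_add,t2_space,second_countable_topology}, 'e::euclidean_space) atlas"
  assumes "lie_group A" "riemannian_metric A m" "orthonormal_basis A m X" "lincomb X p c = lincomb X p d"
  shows "c = d"
  using coeffs_lincomb[OF assms(1-3), of "\<lambda>_. lincomb X p c" _ "\<lambda>_. p"] assms(4) by metis

lemma lincomb_scaleR: "lincomb X p (a *\<^sub>R c) f = a * lincomb X p c f"
  by (simp add: lincomb_def sum_distrib_left mult_ac)

lemma lincomb_add: "lincomb X p (c + d) f = lincomb X p c f + lincomb X p d f"
  by (simp add: lincomb_def sum.distrib algebra_simps)

text \<open>Left-invariant fields are constant coefficient vectors in the frame \<open>X\<close>, so the axis of a slant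
  helix is a unit vector in coordinates.\<close>

lemma slant_helix_iff_coeffs:
  fixes A :: "('g::{group_add,t2_space,second_countable_topology}, 'e::euclidean_space) atlas"
  assumes A: "lie_group A" and m: "riemannian_metric A m" and X: "orthonormal_basis A m X"
    and N: "smooth_field_along m X I \<alpha> N"
  shows "slant_helix A m I \<alpha> N \<longleftrightarrow> (\<exists>y. norm y = 1 \<and>
    (\<exists>\<theta>\<in>{0..pi}. \<theta> \<noteq> pi / 2 \<and> (\<forall>s\<in>I. coeffs m X \<alpha> N s \<bullet> y = cos \<theta>)))" (is "?L \<longleftrightarrow> ?R")
proof -
  have len: "sqrt (m p (lincomb X p y) (lincomb X p y)) = norm y" for p y
    by (simp add: metric_lincomb[OF A m X] norm_eq_sqrt_inner)
  have N': "m (\<alpha> s) (N s) (lincomb X (\<alpha> s) y) = coeffs m X \<alpha> N s \<bullet> y" if "s \<in> I" for s y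
  proof -
    have "N s = lincomb X (\<alpha> s) (coeffs m X \<alpha> N s)"
      using N that unfolding smooth_field_along_def by blast
    then show ?thesis using metric_lincomb[OF A m X] by metis
  qed
  show ?thesis
  proof
    assume ?L
    then obtain Y \<theta> where Y: "Y \<in> lie_algebra A" "\<forall>p. sqrt (m p (Y p) (Y p)) = 1"
      and \<theta>: "\<theta> \<in> {0..pi}" "\<theta> \<noteq> pi / 2" "\<forall>s\<in>I. m (\<alpha> s) (N s) (Y (\<alpha> s)) = cos \<theta>"
      unfolding slant_helix_def by blast
    from X Y(1) obtain y where y: "Y = (\<lambda>p. lincomb X p y)"
      unfolding orthonormal_basis_def by blast
    from Y(2) \<theta> show ?R by (intro exI[of _ y] conjI bexI[of _ \<theta>]) (auto simp: y len N')
  next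
    assume ?R
    then obtain y \<theta> where "norm y = 1" "\<theta> \<in> {0..pi}" "\<theta> \<noteq> pi / 2" "\<forall>s\<in>I. coeffs m X \<alpha> N s \<bullet> y = cos \<theta>"
      by blast
    then show ?L unfolding slant_helix_def
      by (intro bexI[of _ "\<lambda>p. lincomb X p y"] conjI bexI[of _ \<theta>] lincomb_in_lie_algebra[OF A X])
        (auto simp: len N')
  qed
qed

lemma smooth_on_has_vector_derivative:
  fixes f :: "real \<Rightarrow> 'a::real_normed_vector"
  assumes "open I" "smooth_on I f"
  shows "s \<in> I \<Longrightarrow> (f has_vector_derivative vector_derivative f (at s)) (at s)"
    and "smooth_on I (\<lambda>s. vector_derivative f (at s))"
proof -
  have f: "Ck_on (Suc n) I f" for n using assms(2) unfolding smooth_on_def by blast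
  have vd: "(f has_vector_derivative vector_derivative f (at s)) (at s)" if "s \<in> I" for s
    using f[of 0] that by (simp flip: vector_derivative_works)
  then show "s \<in> I \<Longrightarrow> (f has_vector_derivative vector_derivative f (at s)) (at s)" .
  show "smooth_on I (\<lambda>s. vector_derivative f (at s))"
    unfolding smooth_on_def
  proof
    fix n
    show "Ck_on n I (\<lambda>s. vector_derivative f (at s))"
    proof (rule Ck_on_cong[OF assms(1)])
      show "Ck_on n I (\<lambda>s. frechet_derivative f (at s) 1)" using f[of n] by simp
      show "frechet_derivative f (at s) 1 = vector_derivative f (at s)" if "s \<in> I" for s
        using f[of 0] that by (simp add: frechet_derivative_eq_vector_derivative)
    qed
  qed
qed

text \<open>Curvature and torsion are given only through the Frenet equations; written as inner products such as
  \<open>t' \<bullet> n\<close> and \<open>n' \<bullet> b\<close> they are seen to be differentiable.\<close>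

lemma smooth_on_inner_differentiable:
  fixes f g :: "real \<Rightarrow> 'a::real_inner"
  assumes "open I" "smooth_on I f" "smooth_on I g" "s \<in> I"
    and "\<And>r. r \<in> I \<Longrightarrow> h r = vector_derivative f (at r) \<bullet> g r"
  shows "h differentiable (at s)"
proof -
  have "Ck_on (Suc 0) I (\<lambda>s. vector_derivative f (at s))" "Ck_on (Suc 0) I g"
    using smooth_on_has_vector_derivative(2)[OF assms(1,2)] assms(3) unfolding smooth_on_def by blast+
  then have "(\<lambda>r. vector_derivative f (at r)) differentiable (at s)" "g differentiable (at s)"
    using assms(4) by auto
  then have "(\<lambda>r. vector_derivative f (at r) \<bullet> g r) differentiable (at s)"
    by (rule differentiable_inner)
  then obtain D where "((\<lambda>r. vector_derivative f (at r) \<bullet> g r) has_derivative D) (at s)"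
    unfolding differentiable_def ..
  then have "(h has_derivative D) (at s)"
    by (rule has_derivative_transform_within_open[OF _ assms(1,4)]) (simp add: assms(5))
  then show ?thesis by (auto simp: differentiable_def)
qed

lemma abelian_frenet_frame:
  fixes A :: "('g::{ab_group_add,t2_space,second_countable_topology}, 'e::euclidean_space) atlas"
  assumes A: "lie_group A" and m: "riemannian_metric A m" and X: "orthonormal_basis A m X"
    and I: "open I" "is_interval I" "I \<noteq> {}"
    and fr: "frenet_apparatus A m X I \<alpha> T N B \<kappa> \<tau>"
  shows "frenet_frame I (coeffs m X \<alpha> T) (coeffs m X \<alpha> N) (coeffs m X \<alpha> B) \<kappa> \<tau>"
proof -
  define t n b where "t = coeffs m X \<alpha> T" and "n = coeffs m X \<alpha> N" and "b = coeffs m X \<alpha> B"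
  have sm: "smooth_on I t" "smooth_on I n" "smooth_on I b"
    using fr unfolding frenet_apparatus_def smooth_field_along_def t_def n_def b_def by auto
  have frame: "T s = lincomb X (\<alpha> s) (t s)" "N s = lincomb X (\<alpha> s) (n s)" "B s = lincomb X (\<alpha> s) (b s)"
    if "s \<in> I" for s
    using fr that unfolding frenet_apparatus_def smooth_field_along_def t_def n_def b_def by auto
  note vd = smooth_on_has_vector_derivative(1)[OF I(1)]
  note inj = lincomb_inject[OF A m X]
  have unit: "t s \<bullet> t s = 1" "n s \<bullet> n s = 1" "t s \<bullet> n s = 0" if "s \<in> I" for s
    using fr that metric_lincomb[OF A m X, of "\<alpha> s"] frame[OF that] unfolding frenet_apparatus_def by auto
  have cross: "b s = cross3 (t s) (n s)" if "s \<in> I" for s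
    using fr that frame(3)[OF that] inj unfolding frenet_apparatus_def cross_along_def t_def n_def by metis
  have orth: "t s \<bullet> b s = 0" "n s \<bullet> b s = 0" if "s \<in> I" for s
    using cross[OF that] by (simp_all add: dot_cross_self)
  have b1: "b s \<bullet> b s = 1" if "s \<in> I" for s
    using unit[OF that] cross[OF that] norm_cross[of "t s" "n s"] by (simp add: power2_norm_eq_inner)
  note dot = abelian_cov_deriv_along[OF A X] dot_along_def
  have t': "vector_derivative t (at s) = \<kappa> s *\<^sub>R n s" if "s \<in> I" for s
  proof (rule inj, rule ext)
    fix f
    have "cov_deriv_along m X \<alpha> T T s = (\<lambda>f. \<kappa> s * N s f)"
      using fr that unfolding frenet_apparatus_def by blast
    then show "lincomb X (\<alpha> s) (vector_derivative t (at s)) f = lincomb X (\<alpha> s) (\<kappa> s *\<^sub>R n s) f"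
      unfolding dot t_def[symmetric] by (simp add: frame[OF that] lincomb_scaleR)
  qed
  have n': "vector_derivative n (at s) = - \<kappa> s *\<^sub>R t s + \<tau> s *\<^sub>R b s" if "s \<in> I" for s
  proof (rule inj, rule ext)
    fix f
    have "cov_deriv_along m X \<alpha> T N s = (\<lambda>f. - \<kappa> s * T s f + \<tau> s * B s f)"
      using fr that unfolding frenet_apparatus_def by blast
    then show "lincomb X (\<alpha> s) (vector_derivative n (at s)) f
        = lincomb X (\<alpha> s) (- \<kappa> s *\<^sub>R t s + \<tau> s *\<^sub>R b s) f"
      unfolding dot n_def[symmetric] lincomb_add lincomb_scaleR by (simp only: frame[OF that])
  qed
  have b': "vector_derivative b (at s) = - \<tau> s *\<^sub>R n s" if "s \<in> I" for s
  proof (rule inj, rule ext)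
    fix f
    have "cov_deriv_along m X \<alpha> T B s = (\<lambda>f. - \<tau> s * N s f)"
      using fr that unfolding frenet_apparatus_def by blast
    then show "lincomb X (\<alpha> s) (vector_derivative b (at s)) f = lincomb X (\<alpha> s) (- \<tau> s *\<^sub>R n s) f"
      unfolding dot b_def[symmetric] lincomb_scaleR by (simp only: frame[OF that])
  qed
  have \<kappa>: "\<kappa> s > 0" if "s \<in> I" for s using fr that unfolding frenet_apparatus_def by blast
  have "\<kappa> differentiable (at s)" if "s \<in> I" for s
    by (rule smooth_on_inner_differentiable[OF I(1) sm(1,2) that]) (simp add: t' unit)
  moreover have "\<tau> differentiable (at s)" if "s \<in> I" for s
    by (rule smooth_on_inner_differentiable[OF I(1) sm(2,3) that]) (simp add: n' orth b1 inner_simps)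
  ultimately have quot: "(\<lambda>r. \<tau> r / \<kappa> r) field_differentiable (at s)" if "s \<in> I" for s
    using that \<kappa>[OF that]
    by (intro field_differentiable_divide) (auto simp: real_differentiableE field_differentiable_def real_differentiable_def)
  show ?thesis
  proof (unfold_locales, fold t_def n_def b_def)
    show "convex I" using I(2) by (simp add: is_interval_convex)
  qed (use I vd[OF sm(1)] vd[OF sm(2)] vd[OF sm(3)] t' n' b' unit orth b1 \<kappa> quot in auto)
qed

theorem corollary3p8:
  fixes A :: "('g::{ab_group_add,t2_space,second_countable_topology}, real ^ 3) atlas"
    and m :: "'g metric"
    and X :: "3 \<Rightarrow> 'g \<Rightarrow> 'g tvec"
    and I :: "real set"
    and \<alpha> :: "real \<Rightarrow> 'g"
    and T N B :: "real \<Rightarrow> 'g tvec"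
    and \<kappa> \<tau> :: "real \<Rightarrow> real"
  assumes "lie_group A"
    and "bi_invariant_metric A m"
    and "orthonormal_basis A m X"
    and "open I" and "is_interval I" and "I \<noteq> {}"
    and "unit_speed_curve A m I \<alpha>"
    and "frenet_apparatus A m X I \<alpha> T N B \<kappa> \<tau>"
  shows "slant_helix A m I \<alpha> N \<longleftrightarrow>
    (\<forall>s\<in>I. deriv (\<lambda>t. \<tau> t / \<kappa> t) s \<noteq> 0) \<and> (\<exists>c. \<forall>s\<in>I. sigma_N \<kappa> \<tau> s = c)"
proof -
  have m: "riemannian_metric A m" using assms(2) by (simp add: bi_invariant_metric_def)
  interpret frenet_frame I "coeffs m X \<alpha> T" "coeffs m X \<alpha> N" "coeffs m X \<alpha> B" \<kappa> \<tau>
    by (rule abelian_frenet_frame[OF assms(1) m assms(3-6,8)])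
  have "smooth_field_along m X I \<alpha> N" using assms(8) by (simp add: frenet_apparatus_def)
  from slant_helix_iff_coeffs[OF assms(1) m assms(3) this] show ?thesis
    unfolding slant_helix_iff_constant_sigma_N .
qed

end
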